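(* Suppose that $G$ is a PIF group, and let $\mathcal{H}$ be a non-trivial URS of $G$. Then there exists a non-trivial normal subgroup $N$ of $G$ such that $N\leq \mathrm{cl}(H)$ for every $H\in\mathcal{H}$, where $\mathrm{cl}(H)$ is the closure of $H$ in the profinite topology on $G$.
   Context: $\mathrm{Sub}(G)$ is the set of subgroups of $G$ with the topology induced from the product topology on $\{0,1\}^G$, on which $G$ acts by conjugation. A URS of $G$ is a non-empty closed $G$-invariant minimal subset of $\mathrm{Sub}(G)$. The trivial URS is $\{\{1\}\}$. The profinite topology on $G$ has as basis the cosets of finite index normal subgroups; $\mathrm{cl}(H)=\bigcap_N HN$ over all finite index normal subgroups $N$ of $G$. Compact spaces are Hausdorff; a $G$-space is a non-empty space with an action of the discrete group $G$ by homeomorphisms; it is minimal if all orbits are dense. The action of $G$ on $X$ is topologically free if for every $x\in X$, the only element of $G$ acting trivially on a neighbourhood of $x$ is $1$. A compact $G$-space $X$ is profinite if $X$ is totally disconnected and every clopen subset of $X$ has a stabilizer that is open for the profinite topology on $G$ (equivalently, the $G$-action extends to a continuous action of the profinite completion of $G$). A group $G$ is PIF if for every faithful minimal compact $G$-space $X$, if the $G$-action on $X$ is profinite then it is topologically free. *)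

theory Defs
  imports "HOL-Analysis.Analysis" "HOL-Algebra.Group_Action"
begin

text \<open>
  \<open>Sub(G)\<close> is embedded in \<open>{0,1}^G\<close> by indicator functions; these are restricted to the
  carrier because points of a \<open>product_topology\<close> are extensional functions.
\<close>

definition Sub_topology :: "('a, 'm) monoid_scheme \<Rightarrow> 'a set topology" where
  "Sub_topology G =
     pullback_topology {H. subgroup H G} (\<lambda>H. \<lambda>x\<in>carrier G. x \<in> H)
       (product_topology (\<lambda>_. discrete_topology (UNIV :: bool set)) (carrier G))"

definition conj_action :: "('a, 'm) monoid_scheme \<Rightarrow> 'a \<Rightarrow> 'a set \<Rightarrow> 'a set" where
  "conj_action G g = (\<lambda>H\<in>{H. subgroup H G}. g <#\<^bsub>G\<^esub> (H #>\<^bsub>G\<^esub> inv\<^bsub>G\<^esub> g))"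

definition finite_index_normal :: "'a set \<Rightarrow> ('a, 'm) monoid_scheme \<Rightarrow> bool" where
  "finite_index_normal N G \<longleftrightarrow> N \<lhd> G \<and> finite (rcosets\<^bsub>G\<^esub> N)"

text \<open>
  The generating sets below are not only a subbasis but a basis, see
  \<open>openin_profinite_topology_iff\<close>; the closure of a subgroup \<open>H\<close> is the intersection of
  the sets \<open>HN\<close>, see \<open>profinite_closure_of_subgroup\<close>.
\<close>

definition profinite_topology :: "('a, 'm) monoid_scheme \<Rightarrow> 'a topology" where
  "profinite_topology G =
     topology_generated_by {g <#\<^bsub>G\<^esub> N |g N. g \<in> carrier G \<and> finite_index_normal N G}"

definition G_space ::
  "('a, 'm) monoid_scheme \<Rightarrow> 'x topology \<Rightarrow> ('a \<Rightarrow> 'x \<Rightarrow> 'x) \<Rightarrow> bool" where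
  "G_space G X \<phi> \<longleftrightarrow> topspace X \<noteq> {} \<and> group_action G (topspace X) \<phi> \<and>
     (\<forall>g\<in>carrier G. homeomorphic_map X X (\<phi> g))"

definition compact_G_space ::
  "('a, 'm) monoid_scheme \<Rightarrow> 'x topology \<Rightarrow> ('a \<Rightarrow> 'x \<Rightarrow> 'x) \<Rightarrow> bool" where
  "compact_G_space G X \<phi> \<longleftrightarrow> G_space G X \<phi> \<and> compact_space X \<and> Hausdorff_space X"

definition minimal_on ::
  "('a, 'm) monoid_scheme \<Rightarrow> 'x topology \<Rightarrow> ('a \<Rightarrow> 'x \<Rightarrow> 'x) \<Rightarrow> bool" where
  "minimal_on G X \<phi> \<longleftrightarrow> (\<forall>x\<in>topspace X. X closure_of (orbit G \<phi> x) = topspace X)"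

definition topologically_free ::
  "('a, 'm) monoid_scheme \<Rightarrow> 'x topology \<Rightarrow> ('a \<Rightarrow> 'x \<Rightarrow> 'x) \<Rightarrow> bool" where
  "topologically_free G X \<phi> \<longleftrightarrow>
     (\<forall>x\<in>topspace X. \<forall>g\<in>carrier G.
        (\<exists>U. openin X U \<and> x \<in> U \<and> (\<forall>y\<in>U. \<phi> g y = y)) \<longrightarrow> g = \<one>\<^bsub>G\<^esub>)"

definition totally_disconnected :: "'x topology \<Rightarrow> bool" where
  "totally_disconnected X \<longleftrightarrow> (\<forall>S. connectedin X S \<longrightarrow> (\<exists>a. S \<subseteq> {a}))"

definition profinite_G_space ::
  "('a, 'm) monoid_scheme \<Rightarrow> 'x topology \<Rightarrow> ('a \<Rightarrow> 'x \<Rightarrow> 'x) \<Rightarrow> bool" where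
  "profinite_G_space G X \<phi> \<longleftrightarrow> compact_G_space G X \<phi> \<and> totally_disconnected X \<and>
     (\<forall>U. openin X U \<and> closedin X U \<longrightarrow>
        openin (profinite_topology G) {g \<in> carrier G. \<phi> g ` U = U})"

text \<open>
  HOL cannot quantify over types inside a definition, so the defining property of PIF groups
  is first stated for spaces whose points have a given type. A minimal compact \<open>G\<close>-space
  has a dense orbit, so it is determined up to isomorphism by data in the double power set of
  \<open>G\<close>; this is why \<open>'a set set\<close> suffices in the definition of \<open>PIF\<close>. The lemma
  \<open>PIF_imp_PIF_for\<close> below proves that the property then holds for spaces over every type.
\<close>

definition PIF_for :: "'x itself \<Rightarrow> ('a, 'm) monoid_scheme \<Rightarrow> bool" where
  "PIF_for T G \<longleftrightarrow> group G \<and>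
     (\<forall>(X :: 'x topology) \<phi>.
        compact_G_space G X \<phi> \<and> faithful_action G (topspace X) \<phi> \<and> minimal_on G X \<phi> \<and>
        profinite_G_space G X \<phi> \<longrightarrow> topologically_free G X \<phi>)"

definition PIF :: "('a, 'm) monoid_scheme \<Rightarrow> bool" where
  "PIF (G :: ('a, 'm) monoid_scheme) \<longleftrightarrow> PIF_for TYPE('a set set) G"

definition URS :: "('a, 'm) monoid_scheme \<Rightarrow> 'a set set \<Rightarrow> bool" where
  "URS G \<H> \<longleftrightarrow> \<H> \<noteq> {} \<and> closedin (Sub_topology G) \<H> \<and>
     (\<forall>g\<in>carrier G. conj_action G g ` \<H> = \<H>) \<and>
     minimal_on G (subtopology (Sub_topology G) \<H>) (conj_action G)"


context group
begin

lemma finite_index_normal_Int: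
  assumes "finite_index_normal M G" "finite_index_normal N G"
  shows "finite_index_normal (M \<inter> N) G"
proof -
  interpret M: normal M G using assms by (simp add: finite_index_normal_def)
  interpret N: normal N G using assms by (simp add: finite_index_normal_def)
  have sub: "subgroup (M \<inter> N) G"
    using M.subgroup_axioms N.subgroup_axioms subgroups_Inter_pair by blast
  have nrm: "M \<inter> N \<lhd> G"
    using sub M.inv_op_closed2 N.inv_op_closed2 by (auto simp: normal_inv_iff)
  have cos: "(M \<inter> N) #> g = (M #> g) \<inter> (N #> g)" if "g \<in> carrier G" for g
  proof
    show "(M #> g) \<inter> (N #> g) \<subseteq> (M \<inter> N) #> g"
    proof
      fix x assume "x \<in> (M #> g) \<inter> (N #> g)"
      then obtain m n where mn: "m \<in> M" "x = m \<otimes> g" "n \<in> N" "x = n \<otimes> g"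
        by (auto simp: r_coset_def)
      then have "m = n"
        using that M.mem_carrier N.mem_carrier by (metis right_cancel)
      then show "x \<in> (M \<inter> N) #> g" using mn by (auto simp: r_coset_def)
    qed
  qed (auto simp: r_coset_def)
  have "(rcosets (M \<inter> N)) \<subseteq> (\<lambda>(A, B). A \<inter> B) ` ((rcosets M) \<times> (rcosets N))"
    using cos by (force simp: RCOSETS_def)
  moreover have "finite ((rcosets M) \<times> (rcosets N))"
    using assms by (simp add: finite_index_normal_def)
  ultimately have "finite (rcosets (M \<inter> N))"
    using finite_surj by blast
  then show ?thesis using nrm by (simp add: finite_index_normal_def)
qed

lemma finite_index_normal_carrier: "finite_index_normal (carrier G) G"
proof -
  have "rcosets (carrier G) \<subseteq> {carrier G}"
    using coset_join2[OF _ subgroup_self] by (auto simp: RCOSETS_def)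
  then have "finite (rcosets (carrier G))" by (rule finite_subset) simp
  moreover have "carrier G \<lhd> G"
    using subgroup_self by (simp add: normal_inv_iff)
  ultimately show ?thesis by (simp add: finite_index_normal_def)
qed

lemma l_coset_repr_eq:
  assumes "subgroup N G" "g \<in> carrier G" "x \<in> g <# N"
  shows "x <# N = g <# N"
  using assms l_repr_independence by blast

lemma openin_profinite_topology_iff:
  "openin (profinite_topology G) U \<longleftrightarrow>
     U \<subseteq> carrier G \<and> (\<forall>x\<in>U. \<exists>N. finite_index_normal N G \<and> x <# N \<subseteq> U)"
proof
  let ?B = "{g <# N |g N. g \<in> carrier G \<and> finite_index_normal N G}"
  assume "openin (profinite_topology G) U"
  then have "generate_topology_on ?B U"
    by (simp add: profinite_topology_def openin_topology_generated_by_iff)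
  then show "U \<subseteq> carrier G \<and> (\<forall>x\<in>U. \<exists>N. finite_index_normal N G \<and> x <# N \<subseteq> U)"
  proof induction
    case (Int a b)
    have "\<exists>N. finite_index_normal N G \<and> x <# N \<subseteq> a \<inter> b" if x: "x \<in> a \<inter> b" for x
    proof -
      obtain M N where "finite_index_normal M G" "x <# M \<subseteq> a" "finite_index_normal N G" "x <# N \<subseteq> b"
        using Int.IH x by blast
      moreover have "x <# (M \<inter> N) \<subseteq> (x <# M) \<inter> (x <# N)" by (auto simp: l_coset_def)
      ultimately show ?thesis using finite_index_normal_Int by blast
    qed
    then show ?case using Int.IH by blast
  next
    case (Basis s)
    then obtain g N where s: "s = g <# N" "g \<in> carrier G" "finite_index_normal N G" by blast
    have N: "subgroup N G" using s by (simp add: finite_index_normal_def normal_imp_subgroup)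
    have "s \<subseteq> carrier G" using s l_coset_subset_G[OF subgroup.subset[OF N]] by simp
    moreover have "x <# N \<subseteq> s" if "x \<in> s" for x
      using l_coset_repr_eq[OF N s(2)] that s(1) by blast
    ultimately show ?case using s(3) by blast
  qed blast+
next
  assume U: "U \<subseteq> carrier G \<and> (\<forall>x\<in>U. \<exists>N. finite_index_normal N G \<and> x <# N \<subseteq> U)"
  show "openin (profinite_topology G) U"
  proof (subst openin_subopen, intro ballI)
    fix x assume x: "x \<in> U"
    then obtain N where N: "finite_index_normal N G" "x <# N \<subseteq> U" using U by blast
    have "subgroup N G" using N by (simp add: finite_index_normal_def normal_imp_subgroup)
    then have "x \<in> x <# N"
      using x U subgroup.one_closed by (force simp: l_coset_def)
    moreover have "openin (profinite_topology G) (x <# N)"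
      unfolding profinite_topology_def
      by (rule topology_generated_by_Basis) (use x U N in blast)
    ultimately show "\<exists>T. openin (profinite_topology G) T \<and> x \<in> T \<and> T \<subseteq> U"
      using N by blast
  qed
qed

lemma profinite_closure_of_subgroup:
  assumes H: "subgroup H G"
  shows "profinite_topology G closure_of H = (\<Inter>N\<in>{N. finite_index_normal N G}. H <#> N)"
proof -
  have top: "topspace (profinite_topology G) = carrier G"
  proof
    show "topspace (profinite_topology G) \<subseteq> carrier G"
      using openin_profinite_topology_iff openin_topspace by blast
    have "openin (profinite_topology G) (carrier G)"
      unfolding openin_profinite_topology_iff
      using finite_index_normal_carrier l_coset_subset_G by blast
    then show "carrier G \<subseteq> topspace (profinite_topology G)" by (rule openin_subset)
  qed
  have meet: "(x <# N) \<inter> H \<noteq> {} \<longleftrightarrow> x \<in> H <#> N"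
    if x: "x \<in> carrier G" and N: "subgroup N G" for x N
  proof
    assume "(x <# N) \<inter> H \<noteq> {}"
    then obtain n where n: "n \<in> N" "x \<otimes> n \<in> H" by (auto simp: l_coset_def)
    moreover have "x = (x \<otimes> n) \<otimes> inv n"
      using x n subgroup.mem_carrier[OF N] by (simp add: m_assoc)
    ultimately show "x \<in> H <#> N"
      using subgroup.m_inv_closed[OF N] by (force simp: set_mult_def)
  next
    assume "x \<in> H <#> N"
    then obtain h n where hn: "h \<in> H" "n \<in> N" "x = h \<otimes> n" by (auto simp: set_mult_def)
    then have "x \<otimes> inv n = h"
      using subgroup.mem_carrier[OF N] subgroup.mem_carrier[OF H] by (simp add: m_assoc)
    moreover have "x \<otimes> inv n \<in> x <# N"
      using hn subgroup.m_inv_closed[OF N] by (auto simp: l_coset_def)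
    ultimately show "(x <# N) \<inter> H \<noteq> {}" using hn by auto
  qed
  have cl: "x \<in> profinite_topology G closure_of H \<longleftrightarrow>
      x \<in> carrier G \<and> (\<forall>N. finite_index_normal N G \<longrightarrow> (x <# N) \<inter> H \<noteq> {})" for x
  proof -
    have "openin (profinite_topology G) (x <# N) \<and> x \<in> x <# N"
      if "x \<in> carrier G" "finite_index_normal N G" for N
    proof -
      have "subgroup N G" using that by (simp add: finite_index_normal_def normal_imp_subgroup)
      then have "x \<in> x <# N"
        using that subgroup.one_closed by (force simp: l_coset_def)
      moreover have "openin (profinite_topology G) (x <# N)"
        unfolding profinite_topology_def
        by (rule topology_generated_by_Basis) (use that in blast)
      ultimately show ?thesis by blast
    qed
    then have "(x <# N) \<inter> H \<noteq> {}"
      if "x \<in> profinite_topology G closure_of H" "finite_index_normal N G" for N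
      using that unfolding in_closure_of top by (metis disjoint_iff)
    moreover have "x \<in> profinite_topology G closure_of H"
      if x: "x \<in> carrier G" and N: "\<And>N. finite_index_normal N G \<Longrightarrow> (x <# N) \<inter> H \<noteq> {}"
      unfolding in_closure_of top
    proof (intro conjI allI impI)
      fix T assume T: "x \<in> T \<and> openin (profinite_topology G) T"
      then obtain N where "finite_index_normal N G" "x <# N \<subseteq> T"
        using openin_profinite_topology_iff by meson
      then show "\<exists>y. y \<in> H \<and> y \<in> T" using N by blast
    qed (rule x)
    moreover have "x \<in> carrier G" if "x \<in> profinite_topology G closure_of H"
      using that unfolding in_closure_of top by blast
    ultimately show ?thesis by blast
  qed
  have "H <#> carrier G \<subseteq> carrier G"
    using subgroup.subset[OF H] set_mult_closed by blast
  then have "x \<in> carrier G" if "x \<in> (\<Inter>N\<in>{N. finite_index_normal N G}. H <#> N)" for x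
    using that finite_index_normal_carrier by blast
  moreover have "(x <# N) \<inter> H \<noteq> {} \<longleftrightarrow> x \<in> H <#> N"
    if "x \<in> carrier G" "finite_index_normal N G" for x N
    using that meet by (simp add: finite_index_normal_def normal_imp_subgroup)
  ultimately have *: "x \<in> profinite_topology G closure_of H \<longleftrightarrow>
      x \<in> (\<Inter>N\<in>{N. finite_index_normal N G}. H <#> N)" for x
    unfolding cl by (metis (no_types, lifting) INT_iff mem_Collect_eq)
  show ?thesis by (rule Set.set_eqI) (rule *)
qed

end

lemma homeomorphic_G_space_transfer:
  fixes X :: "'x topology" and f :: "'x \<Rightarrow> 'y" and G :: "('a, 'm) monoid_scheme"
  assumes inj: "inj_on f (topspace X)" and prof: "profinite_G_space G X \<phi>"
    and faith: "faithful_action G (topspace X) \<phi>" and minim: "minimal_on G X \<phi>"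
    and free: "\<And>(Y :: 'y topology) \<psi>.
       \<lbrakk>profinite_G_space G Y \<psi>; faithful_action G (topspace Y) \<psi>; minimal_on G Y \<psi>\<rbrakk>
         \<Longrightarrow> topologically_free G Y \<psi>"
  shows "topologically_free G X \<phi>"
proof -
  define E where "E = topspace X"
  define h where "h = inv_into E f"
  define Y where "Y = pullback_topology (f ` E) h X"
  define \<psi> where "\<psi> = (\<lambda>g. \<lambda>y\<in>f ` E. f (\<phi> g (h y)))"
  have comp: "compact_G_space G X \<phi>" and td: "totally_disconnected X"
    and st: "\<And>U. openin X U \<Longrightarrow> closedin X U \<Longrightarrow>
       openin (profinite_topology G) {g \<in> carrier G. \<phi> g ` U = U}"
    using prof by (auto simp: profinite_G_space_def)
  have act: "group_action G E \<phi>" and ne: "E \<noteq> {}"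
    and hom: "\<And>g. g \<in> carrier G \<Longrightarrow> homeomorphic_map X X (\<phi> g)"
    and cs: "compact_space X" "Hausdorff_space X"
    using comp by (auto simp: compact_G_space_def G_space_def E_def)
  interpret group_action G E \<phi> by (rule act)
  interpret grp: group_hom G "BijGroup E" \<phi> by (rule group_hom)
  have injE: "inj_on f E" using inj by (simp add: E_def)
  have hf [simp]: "h (f x) = x" if "x \<in> E" for x
    using that injE by (simp add: h_def)
  have \<phi>E: "\<phi> g x \<in> E" if "g \<in> carrier G" "x \<in> E" for g x
    using element_image that by blast
  have topY: "topspace Y = f ` E"
    unfolding Y_def topspace_pullback_topology E_def[symmetric] by auto
  have openY: "openin Y (f ` U) \<longleftrightarrow> openin X U" if "U \<subseteq> E" for U
  proof
    assume "openin Y (f ` U)"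
    then obtain V where V: "openin X V" "f ` U = h -` V \<inter> f ` E"
      unfolding Y_def openin_pullback_topology by auto
    have "V \<subseteq> E" using V(1) openin_subset by (auto simp: E_def)
    have "x \<in> U \<longleftrightarrow> x \<in> V" if "x \<in> E" for x
    proof -
      have "x \<in> U \<longleftrightarrow> f x \<in> f ` U" using injE that \<open>U \<subseteq> E\<close> by (simp add: inj_on_image_mem_iff)
      then show ?thesis using V(2) that by simp
    qed
    then have "U = V" using \<open>U \<subseteq> E\<close> \<open>V \<subseteq> E\<close> by blast
    then show "openin X U" using V by simp
  next
    assume "openin X U"
    moreover have "f ` U = h -` U \<inter> f ` E" using that by auto
    ultimately show "openin Y (f ` U)"
      unfolding Y_def openin_pullback_topology by auto
  qed
  have hm: "homeomorphic_map X Y f"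
    unfolding homeomorphic_map_def quotient_map_def
  proof (intro conjI allI impI)
    show "f ` topspace X = topspace Y" by (simp add: topY E_def)
    show "inj_on f (topspace X)" by (rule inj)
    fix V assume V: "V \<subseteq> topspace Y"
    have "V = f ` {x \<in> topspace X. f x \<in> V}" using V topY by (auto simp: E_def)
    then show "openin X {x \<in> topspace X. f x \<in> V} = openin Y V"
      using openY[of "{x \<in> topspace X. f x \<in> V}"] by (auto simp: E_def)
  qed
  have sp: "X homeomorphic_space Y"
    using hm homeomorphic_map_imp_homeomorphic_space by blast
  have \<psi>f: "\<psi> g (f x) = f (\<phi> g x)" if "x \<in> E" for g x
    using that by (simp add: \<psi>_def)
  have bij: "\<psi> g \<in> Bij (f ` E)" if g: "g \<in> carrier G" for g
  proof -
    have "inj_on (\<psi> g) (f ` E)"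
    proof (rule inj_onI)
      fix y z assume "y \<in> f ` E" "z \<in> f ` E" "\<psi> g y = \<psi> g z"
      then show "y = z"
        using \<psi>f \<phi>E[OF g] injE inj_prop[OF g] by (auto simp: inj_on_eq_iff)
    qed
    moreover have "\<psi> g ` (f ` E) = f ` (\<phi> g ` E)"
      by (simp add: image_image \<psi>f cong: image_cong)
    ultimately show ?thesis
      unfolding Bij_def bij_betw_def using surj_prop[OF g] by (simp add: \<psi>_def)
  qed
  have act': "group_action G (f ` E) \<psi>"
    unfolding group_action_def group_hom_def group_hom_axioms_def
  proof (intro conjI homI)
    show "group G" by (rule grp.G.is_group)
    show "group (BijGroup (f ` E))" by (rule group_BijGroup)
    show "\<psi> g \<in> carrier (BijGroup (f ` E))" if "g \<in> carrier G" for g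
      using bij[OF that] by (simp add: BijGroup_def)
    show "\<psi> (a \<otimes>\<^bsub>G\<^esub> b) = \<psi> a \<otimes>\<^bsub>BijGroup (f ` E)\<^esub> \<psi> b"
      if ab: "a \<in> carrier G" "b \<in> carrier G" for a b
    proof -
      have "\<psi> (a \<otimes>\<^bsub>G\<^esub> b) y = compose (f ` E) (\<psi> a) (\<psi> b) y" for y
      proof (cases "y \<in> f ` E")
        case True
        then obtain x where "x \<in> E" "y = f x" by blast
        have "\<phi> (a \<otimes>\<^bsub>G\<^esub> b) x = \<phi> a (\<phi> b x)"
          by (rule composition_rule[OF \<open>x \<in> E\<close> ab])
        then show ?thesis
          using True ab \<phi>E \<open>x \<in> E\<close> \<open>y = f x\<close> by (simp add: \<psi>f compose_eq del: grp.hom_mult)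
      next
        case False
        then show ?thesis by (simp add: \<psi>_def compose_def)
      qed
      then show ?thesis
        using ab bij by (auto simp: BijGroup_def)
    qed
  qed
  have hom': "homeomorphic_map Y Y (\<psi> g)" if g: "g \<in> carrier G" for g
  proof -
    have "homeomorphic_map Y X h"
    proof -
      from hm obtain k where k: "homeomorphic_maps X Y f k" using homeomorphic_map_maps by blast
      have "homeomorphic_map Y X k" using k homeomorphic_maps_map by blast
      moreover have "k y = h y" if "y \<in> topspace Y" for y
        using that k by (auto simp: topY homeomorphic_maps_def E_def[symmetric])
      ultimately show ?thesis by (rule homeomorphic_map_eq)
    qed
    then have "homeomorphic_map Y Y (f \<circ> (\<phi> g \<circ> h))"
      by (intro homeomorphic_map_compose[OF _ hm] homeomorphic_map_compose[OF _ hom[OF g]])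
    then show ?thesis
      by (rule homeomorphic_map_eq) (auto simp: \<psi>_def topY)
  qed
  have img: "\<psi> g ` (f ` U) = f ` U \<longleftrightarrow> \<phi> g ` U = U" if "g \<in> carrier G" "U \<subseteq> E" for g U
  proof -
    have "\<psi> g ` (f ` U) = f ` (\<phi> g ` U)"
      using that by (auto simp: image_image \<psi>f subset_iff cong: image_cong)
    moreover have "\<phi> g ` U \<subseteq> E" using that \<phi>E by auto
    ultimately show ?thesis using that injE by (simp add: inj_on_image_eq_iff)
  qed
  have "profinite_G_space G Y \<psi>"
    unfolding profinite_G_space_def compact_G_space_def G_space_def
  proof (intro conjI ballI allI impI)
    show "topspace Y \<noteq> {}" using ne topY by simp
    show "group_action G (topspace Y) \<psi>" using act' topY by simp
    show "homeomorphic_map Y Y (\<psi> g)" if "g \<in> carrier G" for g by (rule hom'[OF that])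
    show "compact_space Y" using cs sp homeomorphic_compact_space by blast
    show "Hausdorff_space Y" using cs sp homeomorphic_Hausdorff_space by blast
    show "totally_disconnected Y"
      unfolding totally_disconnected_def
    proof (intro allI impI)
      fix S assume S: "connectedin Y S"
      then have "S \<subseteq> f ` E" using connectedin_subset_topspace topY by blast
      then obtain U where U: "U \<subseteq> E" "S = f ` U" by (auto simp: subset_image_iff)
      then have "connectedin X U"
        using S hm homeomorphic_map_connectedness by (metis E_def)
      then obtain a where "U \<subseteq> {a}" using td by (auto simp: totally_disconnected_def)
      then show "\<exists>a. S \<subseteq> {a}" using U by blast
    qed
    fix V assume V: "openin Y V \<and> closedin Y V"
    then have "V \<subseteq> f ` E" using openin_subset topY by blast
    then obtain U where U: "U \<subseteq> E" "V = f ` U" by (auto simp: subset_image_iff)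
    have "openin X U" "closedin X U"
      using V U hm homeomorphic_map_openness homeomorphic_map_closedness by (metis E_def)+
    then have "openin (profinite_topology G) {g \<in> carrier G. \<phi> g ` U = U}" by (rule st)
    moreover have "{g \<in> carrier G. \<psi> g ` V = V} = {g \<in> carrier G. \<phi> g ` U = U}"
      unfolding U(2) using img[OF _ U(1)] by (intro Collect_cong conj_cong refl)
    ultimately show "openin (profinite_topology G) {g \<in> carrier G. \<psi> g ` V = V}" by simp
  qed
  moreover have "faithful_action G (topspace Y) \<psi>"
    unfolding faithful_action_def faithful_action_axioms_def
  proof (intro conjI inj_onI)
    show "group_action G (topspace Y) \<psi>" using act' topY by simp
    fix a b assume ab: "a \<in> carrier G" "b \<in> carrier G" "\<psi> a = \<psi> b"
    have eq: "\<phi> a x = \<phi> b x" if "x \<in> E" for x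
    proof -
      have "f (\<phi> a x) = f (\<phi> b x)" using ab that by (metis \<psi>f)
      then show ?thesis using injE \<phi>E ab that by (auto simp: inj_on_eq_iff)
    qed
    have "\<phi> a = \<phi> b"
      by (rule extensionalityI[of _ E])
        (use bij_prop0 ab eq in \<open>auto simp: Bij_def\<close>)
    then show "a = b"
      using faith ab by (auto simp: faithful_action_def faithful_action_axioms_def inj_on_def)
  qed
  moreover have "minimal_on G Y \<psi>"
    unfolding minimal_on_def
  proof
    fix y assume "y \<in> topspace Y"
    then obtain x where x: "x \<in> E" "y = f x" using topY by auto
    have o: "orbit G \<psi> y = f ` orbit G \<phi> x"
      using x by (auto simp: orbit_def \<psi>f)
    have "orbit G \<phi> x \<subseteq> topspace X"
      using x \<phi>E by (auto simp: orbit_def E_def)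
    then have "Y closure_of (f ` orbit G \<phi> x) = f ` (X closure_of orbit G \<phi> x)"
      using hm homeomorphic_map_closure_of by blast
    also have "X closure_of orbit G \<phi> x = E"
      using minim x by (auto simp: minimal_on_def E_def)
    finally show "Y closure_of orbit G \<psi> y = topspace Y" using o topY by simp
  qed
  ultimately have fr: "topologically_free G Y \<psi>" by (rule free)
  show ?thesis
    unfolding topologically_free_def
  proof (intro ballI impI)
    fix x g assume x: "x \<in> topspace X" and g: "g \<in> carrier G"
      and "\<exists>U. openin X U \<and> x \<in> U \<and> (\<forall>y\<in>U. \<phi> g y = y)"
    then obtain U where U: "openin X U" "x \<in> U" "\<forall>y\<in>U. \<phi> g y = y" by blast
    have UE: "U \<subseteq> E" using U openin_subset by (auto simp: E_def)
    have "openin Y (f ` U)" "f x \<in> f ` U" using openY UE U by auto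
    moreover have "\<forall>y\<in>f ` U. \<psi> g y = y" using UE U \<psi>f by auto
    moreover have "f x \<in> topspace Y" using x topY by (simp add: E_def)
    ultimately show "g = \<one>\<^bsub>G\<^esub>"
      using fr g unfolding topologically_free_def by blast
  qed
qed

lemma minimal_Hausdorff_embeds:
  fixes X :: "'x topology" and G :: "('a, 'm) monoid_scheme"
  assumes "Hausdorff_space X" "minimal_on G X \<phi>"
  shows "\<exists>f :: 'x \<Rightarrow> 'a set set. inj_on f (topspace X)"
proof (cases "topspace X = {}")
  case False
  then obtain x0 where x0: "x0 \<in> topspace X" by blast
  define f where
    "f = (\<lambda>x. {{g \<in> carrier G. \<phi> g x0 \<in> U} |U. openin X U \<and> x \<in> U})"
  have dense: "X closure_of (orbit G \<phi> x0) = topspace X"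
    using assms x0 by (auto simp: minimal_on_def)
  have "inj_on f (topspace X)"
  proof (rule inj_onI, rule ccontr)
    fix x y assume xy: "x \<in> topspace X" "y \<in> topspace X" "f x = f y" "x \<noteq> y"
    obtain U V where UV: "openin X U" "openin X V" "x \<in> U" "y \<in> V" "disjnt U V"
      using assms(1) xy(1,2,4) unfolding Hausdorff_space_def by blast
    have "{g \<in> carrier G. \<phi> g x0 \<in> U} \<in> f x"
      using UV(1,3) unfolding f_def by (intro CollectI exI[of _ U] conjI refl)
    then have "{g \<in> carrier G. \<phi> g x0 \<in> U} \<in> f y" using xy(3) by simp
    then obtain W where W: "openin X W" "y \<in> W"
      "{g \<in> carrier G. \<phi> g x0 \<in> U} = {g \<in> carrier G. \<phi> g x0 \<in> W}"
      unfolding f_def mem_Collect_eq by (elim exE conjE)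
    have "openin X (V \<inter> W)" "y \<in> V \<inter> W" using UV W by auto
    moreover have "y \<in> X closure_of (orbit G \<phi> x0)" using dense xy by simp
    ultimately obtain z where z: "z \<in> orbit G \<phi> x0" "z \<in> V \<inter> W"
      unfolding in_closure_of by blast
    then obtain g where "g \<in> carrier G" "z = \<phi> g x0" by (auto simp: orbit_def)
    then have "g \<in> {g \<in> carrier G. \<phi> g x0 \<in> U}" unfolding W(3) using z by simp
    then have "z \<in> U" using \<open>z = \<phi> g x0\<close> by simp
    then show False using z UV(5) by (auto simp: disjnt_iff)
  qed
  then show ?thesis by (rule exI[of _ f])
qed simp

lemma PIF_imp_PIF_for:
  fixes G :: "('a, 'm) monoid_scheme"
  assumes "PIF G"
  shows "PIF_for TYPE('x) G"
  unfolding PIF_for_def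
proof (intro conjI allI impI; (elim conjE)?)
  show "group G" using assms by (simp add: PIF_def PIF_for_def)
  fix X :: "'x topology" and \<phi>
  assume X: "compact_G_space G X \<phi>" "faithful_action G (topspace X) \<phi>"
    "minimal_on G X \<phi>" "profinite_G_space G X \<phi>"
  obtain f :: "'x \<Rightarrow> 'a set set" where f: "inj_on f (topspace X)"
    using minimal_Hausdorff_embeds[of X G \<phi>] X(1,3) by (auto simp: compact_G_space_def)
  show "topologically_free G X \<phi>"
  proof (rule homeomorphic_G_space_transfer[OF f X(4) X(2) X(3)])
    fix Y :: "'a set set topology" and \<psi>
    assume "profinite_G_space G Y \<psi>" "faithful_action G (topspace Y) \<psi>" "minimal_on G Y \<psi>"
    then show "topologically_free G Y \<psi>"
      using assms unfolding PIF_def PIF_for_def profinite_G_space_def by blast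
  qed
qed

end

theory Submission
  imports Defs "HOL-Algebra.Zassenhaus"
begin

text \<open>
  Fix \<open>H \<noteq> {\<one>}\<close> in the URS and consider the inverse limit \<open>Y\<close> of the coset spaces \<open>G/HN\<close>, over all normal
  subgroups \<open>N\<close> of finite index, with \<open>G\<close> acting by translation. In terms of the profinite completion,
  \<open>Y\<close> is the quotient of the completion by the closure of the image of \<open>H\<close>. It is a minimal profinite
  \<open>G\<close>-space, and an element acting trivially on \<open>Y\<close> fixes the base point, hence lies in \<open>HN\<close> for every
  \<open>N\<close>, that is, in \<open>cl(H)\<close>.
  
  The main point is that \<open>Y\<close> is not topologically free (\<open>URS_coset_limit_not_topologically_free\<close>).
  Take \<open>h \<noteq> \<one>\<close> in \<open>H\<close>. By minimality and compactness of the URS there is a finite set \<open>S\<close> such that every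
  member of the URS, in particular every conjugate of \<open>H\<close>, contains \<open>s\<^sup>-\<^sup>1hs\<close> for some \<open>s \<in> S\<close>. So \<open>G\<close> is
  covered by the finitely many sets of all \<open>g\<close> with \<open>g\<^sup>-\<^sup>1kg \<in> cl(H)\<close>, where \<open>k\<close> ranges over the elements
  \<open>s\<^sup>-\<^sup>1hs\<close>. These sets are closed in the profinite topology, so one of them contains a coset \<open>tN\<close>
  (\<open>URS_conjugators_have_interior\<close>). The condition \<open>g\<^sup>-\<^sup>1kg \<in> cl(H)\<close> means that \<open>k\<close> fixes the point
  \<open>g\<close> of \<open>Y\<close>, and so \<open>k \<noteq> \<one>\<close> fixes a non-empty open subset of \<open>Y\<close> pointwise.
  
  Since \<open>G\<close> is PIF, the action on \<open>Y\<close> cannot be faithful (\<open>PIF_kernel_nontrivial\<close>). Its kernel \<open>M\<close> is a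
  non-trivial normal subgroup contained in \<open>cl(H)\<close>. For fixed \<open>N\<close>, the inclusion \<open>M \<subseteq> HN\<close> depends on
  finitely many elements of \<open>H\<close> only, and some conjugate of any other member \<open>H'\<close> of the URS contains
  these elements; as \<open>M\<close> and \<open>N\<close> are normal, this gives \<open>M \<subseteq> H'N\<close>
  (\<open>normal_subset_closure_transfer\<close>).
\<close>

section \<open>Uniformly recurrent subgroups\<close>

lemma compact_space_pullback:
  assumes "compactin X (f ` A)"
  shows "compact_space (pullback_topology A f X)"
  unfolding compact_space_def compactin_def
proof (intro conjI allI impI; (elim conjE)?)
  have top: "topspace (pullback_topology A f X) = A"
    using compactin_subset_topspace[OF assms] by (auto simp: topspace_pullback_topology)
  fix \<U> assume op: "\<forall>U\<in>\<U>. openin (pullback_topology A f X) U"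
    and cov: "topspace (pullback_topology A f X) \<subseteq> \<Union>\<U>"
  from op obtain V where V: "\<And>U. U \<in> \<U> \<Longrightarrow> openin X (V U) \<and> U = f -` V U \<inter> A"
    unfolding openin_pullback_topology by metis
  have "f ` A \<subseteq> \<Union>(V ` \<U>)" using cov V unfolding top by fastforce
  then obtain \<F> where \<F>: "finite \<F>" "\<F> \<subseteq> V ` \<U>" "f ` A \<subseteq> \<Union>\<F>"
    using assms[unfolded compactin_def, THEN conjunct2, rule_format, of "V ` \<U>"] V by auto
  then obtain \<G> where \<G>: "finite \<G>" "\<G> \<subseteq> \<U>" "\<F> = V ` \<G>"
    by (metis finite_subset_image)
  have "A \<subseteq> \<Union>\<G>"
  proof
    fix x assume "x \<in> A"
    then obtain U where "U \<in> \<G>" "f x \<in> V U" using \<F>(3) \<G>(3) by blast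
    then have "x \<in> U" using V[of U] \<G>(2) \<open>x \<in> A\<close> by blast
    then show "x \<in> \<Union>\<G>" using \<open>U \<in> \<G>\<close> by blast
  qed
  then show "\<exists>\<F>. finite \<F> \<and> \<F> \<subseteq> \<U> \<and> topspace (pullback_topology A f X) \<subseteq> \<Union>\<F>"
    using \<G> top by blast
qed simp

context group
begin

lemma openin_cylinder_subgroups:
  assumes "a \<in> carrier G"
  shows "openin (Sub_topology G) {H. subgroup H G \<and> a \<in> H}"
proof -
  let ?P = "product_topology (\<lambda>_. discrete_topology (UNIV :: bool set)) (carrier G)"
  have "openin ?P {u \<in> topspace ?P. u a \<in> {True}}"
    using assms by (intro openin_continuous_map_preimage[OF continuous_map_product_projection]) auto
  moreover have "{H. subgroup H G \<and> a \<in> H} =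
      (\<lambda>H. \<lambda>x\<in>carrier G. x \<in> H) -` {u \<in> topspace ?P. u a \<in> {True}} \<inter> {H. subgroup H G}"
    using assms by auto
  ultimately show ?thesis
    unfolding Sub_topology_def openin_pullback_topology by blast
qed

lemma topspace_Sub_topology: "topspace (Sub_topology G) = {H. subgroup H G}"
  by (auto simp: Sub_topology_def topspace_pullback_topology)

text \<open>
  Being the indicator function of a subgroup is a conjunction of conditions that each involve at
  most three coordinates, so these functions form a closed subset of the cube.
\<close>

lemma compact_space_Sub_topology: "compact_space (Sub_topology G)"
  unfolding Sub_topology_def
proof (rule compact_space_pullback)
  let ?P = "product_topology (\<lambda>_. discrete_topology (UNIV :: bool set)) (carrier G)"
  let ?f = "\<lambda>H. \<lambda>x\<in>carrier G. x \<in> H"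
  let ?T = "\<lambda>a. {u \<in> topspace ?P. u a \<in> {True}}"
  let ?F = "\<lambda>a. {u \<in> topspace ?P. u a \<in> {False}}"
  have cl: "closedin ?P {u \<in> topspace ?P. u a \<in> B}" if "a \<in> carrier G" for a B
    using that by (intro closedin_continuous_map_preimage[OF continuous_map_product_projection]) auto
  have "?f ` {H. subgroup H G} =
      ?T \<one> \<inter> (\<Inter>a\<in>carrier G. \<Inter>b\<in>carrier G. ?F a \<union> ?F b \<union> ?T (a \<otimes> inv b))"
    (is "_ = ?C")
  proof
    show "?f ` {H. subgroup H G} \<subseteq> ?C"
      by (auto simp: subgroup.one_closed subgroup.m_closed subgroup.m_inv_closed)
    show "?C \<subseteq> ?f ` {H. subgroup H G}"
    proof
      fix u assume u: "u \<in> ?C"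
      let ?H = "{a \<in> carrier G. u a}"
      have ext: "u \<in> extensional (carrier G)" and one: "u \<one>" using u by (auto simp: PiE_def)
      have div: "u (a \<otimes> inv b)" if "a \<in> ?H" "b \<in> ?H" for a b
        using u that by auto
      have inv: "u (inv b)" if "b \<in> ?H" for b using div[of \<one> b] one that by simp
      have "u (a \<otimes> b)" if "a \<in> ?H" "b \<in> ?H" for a b
        using div[of a "inv b"] inv that by simp
      then have "subgroup ?H G"
        using one inv by (intro subgroupI) auto
      moreover have "u = ?f ?H" using ext by (auto simp: fun_eq_iff extensional_def)
      ultimately show "u \<in> ?f ` {H. subgroup H G}" by blast
    qed
  qed
  moreover have "closedin ?P ?C"
    by (intro closedin_Int closedin_INT closedin_Un cl) auto
  moreover have "compact_space ?P"
    by (simp add: compact_space_product_topology compact_space_discrete_topology)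
  ultimately show "compactin ?P (?f ` {H. subgroup H G})"
    using closedin_compact_space by simp
qed

lemma mem_conj_action_iff:
  assumes "subgroup H G" "g \<in> carrier G" "a \<in> carrier G"
  shows "a \<in> conj_action G g H \<longleftrightarrow> inv g \<otimes> a \<otimes> g \<in> H"
proof -
  note [simp] = subgroup.mem_carrier[OF assms(1)]
  have "a \<in> conj_action G g H \<longleftrightarrow> (\<exists>h\<in>H. a = g \<otimes> (h \<otimes> inv g))"
    using assms(1) by (auto simp: conj_action_def l_coset_def r_coset_def)
  also have "\<dots> \<longleftrightarrow> inv g \<otimes> a \<otimes> g \<in> H"
  proof
    assume "inv g \<otimes> a \<otimes> g \<in> H"
    moreover have "a = g \<otimes> ((inv g \<otimes> a \<otimes> g) \<otimes> inv g)"
      using assms by (simp add: m_assoc[symmetric]) (simp add: m_assoc)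
    ultimately show "\<exists>h\<in>H. a = g \<otimes> (h \<otimes> inv g)" by blast
  next
    assume "\<exists>h\<in>H. a = g \<otimes> (h \<otimes> inv g)"
    then obtain h where h: "h \<in> H" "a = g \<otimes> (h \<otimes> inv g)" by blast
    then have "inv g \<otimes> a \<otimes> g = h"
      using assms by (simp add: m_assoc inv_solve_left')
    then show "inv g \<otimes> a \<otimes> g \<in> H" using h by simp
  qed
  finally show ?thesis .
qed

lemma URS_subgroup: "URS G \<H> \<Longrightarrow> H \<in> \<H> \<Longrightarrow> subgroup H G"
  using closedin_subset[of "Sub_topology G" \<H>] topspace_Sub_topology by (auto simp: URS_def)

text \<open>
  The subgroups containing \<open>F\<close> form a neighbourhood of \<open>H\<close>, which meets the dense orbit of \<open>H'\<close>.
\<close>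

lemma URS_conjugate_contains_finite:
  assumes U: "URS G \<H>" and H: "H \<in> \<H>" "H' \<in> \<H>" and F: "finite F" "F \<subseteq> H"
  shows "\<exists>g\<in>carrier G. F \<subseteq> conj_action G g H'"
proof -
  let ?X = "subtopology (Sub_topology G) \<H>"
  have top: "topspace ?X = \<H>" using URS_subgroup[OF U] topspace_Sub_topology by auto
  have Fc: "F \<subseteq> carrier G" using F URS_subgroup[OF U H(1)] subgroup.subset by blast
  define W where "W = topspace (Sub_topology G) \<inter> (\<Inter>a\<in>F. {H. subgroup H G \<and> a \<in> H})"
  have "openin (Sub_topology G) W"
    unfolding W_def using F(1) Fc openin_cylinder_subgroups
    by (intro openin_Int_Inter) auto
  then have "openin ?X (\<H> \<inter> W)" by (simp add: openin_subtopology_Int2)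
  moreover have "H \<in> \<H> \<inter> W"
    using URS_subgroup[OF U H(1)] H F by (auto simp: W_def topspace_Sub_topology)
  moreover have "H \<in> ?X closure_of orbit G (conj_action G) H'"
    using U H top by (auto simp: URS_def minimal_on_def)
  ultimately obtain K where "K \<in> orbit G (conj_action G) H'" "K \<in> W"
    unfolding in_closure_of by blast
  then show ?thesis by (auto simp: orbit_def W_def)
qed

text \<open>
  The sets of subgroups containing a given conjugate of \<open>h\<close> are open, and by minimality they cover the
  URS, which is compact.
\<close>

lemma URS_finitely_many_conjugates:
  assumes U: "URS G \<H>" and H: "H \<in> \<H>" "h \<in> H"
  shows "\<exists>S. finite S \<and> S \<subseteq> carrier G \<and> (\<forall>H'\<in>\<H>. \<exists>s\<in>S. inv s \<otimes> h \<otimes> s \<in> H')"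
proof -
  have h: "h \<in> carrier G" by (rule subgroup.mem_carrier[OF URS_subgroup[OF U H(1)] H(2)])
  let ?V = "\<lambda>s. {H'. subgroup H' G \<and> inv s \<otimes> h \<otimes> s \<in> H'}"
  have comp: "compactin (Sub_topology G) \<H>"
    using U compact_space_Sub_topology closedin_compact_space by (auto simp: URS_def)
  have op: "openin (Sub_topology G) (?V s)" if "s \<in> carrier G" for s
    using that h by (intro openin_cylinder_subgroups) auto
  have "\<H> \<subseteq> (\<Union>s\<in>carrier G. ?V s)"
  proof
    fix H' assume H': "H' \<in> \<H>"
    obtain s where "s \<in> carrier G" "h \<in> conj_action G s H'"
      using URS_conjugate_contains_finite[OF U H(1) H', of "{h}"] H(2) by auto
    then show "H' \<in> (\<Union>s\<in>carrier G. ?V s)"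
      using URS_subgroup[OF U H'] mem_conj_action_iff h by auto
  qed
  then obtain \<F> where \<F>: "finite \<F>" "\<F> \<subseteq> ?V ` carrier G" "\<H> \<subseteq> \<Union>\<F>"
    using comp[unfolded compactin_def, THEN conjunct2, rule_format, of "?V ` carrier G"] op by auto
  then obtain S where S: "S \<subseteq> carrier G" "finite S" "\<F> = ?V ` S"
    using finite_subset_image[OF \<F>(1,2)] by (elim exE conjE) (rule that)
  show ?thesis
  proof (intro exI[of _ S] conjI ballI)
    fix H' assume "H' \<in> \<H>"
    then show "\<exists>s\<in>S. inv s \<otimes> h \<otimes> s \<in> H'" using \<F>(3) unfolding S(3) by blast
  qed (use S in simp_all)
qed

end

section \<open>A conjugator set with non-empty profinite interior\<close>

text \<open>
  A finite form of the Baire property, valid in every topological space: if \<open>U\<close> is not contained in the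
  closed set \<open>C\<close>, then \<open>U - C\<close> is a non-empty open set covered by the remaining ones.
\<close>

lemma finite_closed_cover_has_interior:
  assumes "finite \<C>" "\<And>C. C \<in> \<C> \<Longrightarrow> closedin X C"
    and "openin X U" "U \<noteq> {}" "U \<subseteq> \<Union>\<C>"
  shows "\<exists>C\<in>\<C>. \<exists>V. openin X V \<and> V \<noteq> {} \<and> V \<subseteq> C"
  using assms
proof (induction \<C> arbitrary: U rule: finite_induct)
  case empty
  then show ?case by simp
next
  case (insert C \<C>)
  show ?case
  proof (cases "U \<subseteq> C")
    case True
    then show ?thesis using insert.prems by (intro bexI[of _ C] exI[of _ U]) auto
  next
    case False
    have "\<exists>D\<in>\<C>. \<exists>V. openin X V \<and> V \<noteq> {} \<and> V \<subseteq> D"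
    proof (rule insert.IH)
      show "openin X (U - C)" using insert.prems by (intro openin_diff) auto
      show "U - C \<noteq> {}" "U - C \<subseteq> \<Union>\<C>" using False insert.prems by auto
      show "closedin X D" if "D \<in> \<C>" for D using insert.prems that by simp
    qed
    then show ?thesis by blast
  qed
qed

context group
begin

lemma finite_index_normalD:
  assumes "finite_index_normal N G"
  shows "N \<lhd> G" "subgroup N G" "finite (rcosets N)"
  using assms by (auto simp: finite_index_normal_def normal_imp_subgroup)

lemma subgroup_mult_normal:
  assumes "subgroup H G" "N \<lhd> G"
  shows "subgroup (H <#> N) G" "H \<subseteq> H <#> N" "N \<subseteq> H <#> N"
proof -
  have N: "subgroup N G" using assms by (simp add: normal_imp_subgroup)
  show "subgroup (H <#> N) G"
    using mult_norm_subgroup[OF assms(2,1)] commut_normal[OF assms] by simp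
  show "H \<subseteq> H <#> N"
  proof
    fix h assume "h \<in> H"
    then have "h = h \<otimes> \<one>" using subgroup.mem_carrier[OF assms(1)] by simp
    then show "h \<in> H <#> N"
      using \<open>h \<in> H\<close> subgroup.one_closed[OF N] unfolding set_mult_def by blast
  qed
  show "N \<subseteq> H <#> N"
  proof
    fix n assume "n \<in> N"
    then have "n = \<one> \<otimes> n" using subgroup.mem_carrier[OF N] by simp
    then show "n \<in> H <#> N"
      using \<open>n \<in> N\<close> subgroup.one_closed[OF assms(1)] unfolding set_mult_def by blast
  qed
qed

lemma topspace_profinite_topology: "topspace (profinite_topology G) = carrier G"
proof
  show "topspace (profinite_topology G) \<subseteq> carrier G"
    using openin_topspace[of "profinite_topology G"] unfolding openin_profinite_topology_iff by simp
  have "openin (profinite_topology G) (carrier G)"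
    unfolding openin_profinite_topology_iff
    using finite_index_normal_carrier l_coset_subset_G by blast
  then show "carrier G \<subseteq> topspace (profinite_topology G)" by (rule openin_subset)
qed

lemma mult_inv_cancel_left: "a \<in> carrier G \<Longrightarrow> b \<in> carrier G \<Longrightarrow> a \<otimes> (inv a \<otimes> b) = b"
  by (simp add: m_assoc[symmetric])

text \<open>
  The two conjugates differ by conjugation with \<open>x\<close>, which lies in \<open>K\<close>. Membership therefore depends
  only on the coset \<open>gK\<close>.
\<close>

lemma conjugate_mem_right_invariant:
  assumes "subgroup K G" "k \<in> carrier G" "g \<in> carrier G" "x \<in> K"
  shows "inv (g \<otimes> x) \<otimes> k \<otimes> (g \<otimes> x) \<in> K \<longleftrightarrow> inv g \<otimes> k \<otimes> g \<in> K"
proof -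
  interpret K: subgroup K G by (rule assms(1))
  have eq: "inv (g \<otimes> x) \<otimes> k \<otimes> (g \<otimes> x) = inv x \<otimes> (inv g \<otimes> k \<otimes> g) \<otimes> x"
    using assms by (simp add: inv_mult_group m_assoc)
  have "inv g \<otimes> k \<otimes> g = x \<otimes> (inv (g \<otimes> x) \<otimes> k \<otimes> (g \<otimes> x)) \<otimes> inv x"
    unfolding eq using assms by (simp add: m_assoc mult_inv_cancel_left)
  then show ?thesis
    using eq assms(4) K.m_closed K.m_inv_closed by metis
qed

text \<open>
  The condition on \<open>g\<close> says that \<open>k\<close> lies in the profinite closure of the conjugate of \<open>H\<close> by \<open>g\<close>.
  For each single \<open>N\<close> it depends only on the coset \<open>gHN\<close>, so it cuts out a clopen set.
\<close>

lemma closedin_conjugators_into_closure: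
  assumes "subgroup H G" "k \<in> carrier G"
  shows "closedin (profinite_topology G)
    {g \<in> carrier G. \<forall>N. finite_index_normal N G \<longrightarrow> inv g \<otimes> k \<otimes> g \<in> H <#> N}" (is "closedin _ ?C")
proof -
  have "openin (profinite_topology G) (carrier G - ?C)"
    unfolding openin_profinite_topology_iff
  proof (intro conjI ballI)
    fix g assume "g \<in> carrier G - ?C"
    then obtain N where g: "g \<in> carrier G" and N: "finite_index_normal N G"
      and notin: "inv g \<otimes> k \<otimes> g \<notin> H <#> N" by blast
    note HN = subgroup_mult_normal[OF assms(1) finite_index_normalD(1)[OF N]]
    have "g <# N \<subseteq> carrier G - ?C"
    proof
      fix y assume "y \<in> g <# N"
      then obtain n where n: "n \<in> N" "y = g \<otimes> n" by (auto simp: l_coset_def)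
      then have "inv y \<otimes> k \<otimes> y \<notin> H <#> N"
        using conjugate_mem_right_invariant[OF HN(1) assms(2) g, of n] HN(3) notin by auto
      moreover have "y \<in> carrier G"
        using n g subgroup.mem_carrier[OF finite_index_normalD(2)[OF N]] by simp
      ultimately show "y \<in> carrier G - ?C" using N by blast
    qed
    then show "\<exists>N. finite_index_normal N G \<and> g <# N \<subseteq> carrier G - ?C" using N by blast
  qed blast
  then show ?thesis by (auto simp: closedin_def topspace_profinite_topology)
qed

text \<open>
  The conjugates of \<open>H\<close> are members of the URS, so each contains one of finitely many conjugates \<open>k\<close> of
  \<open>h\<close>. This covers \<open>G\<close> by finitely many profinitely closed sets, and one of them has non-empty interior.
\<close>

lemma URS_conjugators_have_interior:
  assumes U: "URS G \<H>" and H: "H \<in> \<H>" "h \<in> H" "h \<noteq> \<one>"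
  shows "\<exists>k t N. k \<in> carrier G \<and> k \<noteq> \<one> \<and> t \<in> carrier G \<and> finite_index_normal N G \<and>
    (\<forall>g\<in>t <# N. \<forall>M. finite_index_normal M G \<longrightarrow> inv g \<otimes> k \<otimes> g \<in> H <#> M)"
proof -
  have sH: "subgroup H G" by (rule URS_subgroup[OF U H(1)])
  have h: "h \<in> carrier G" by (rule subgroup.mem_carrier[OF sH H(2)])
  obtain S where S: "finite S" "S \<subseteq> carrier G"
    "\<And>H'. H' \<in> \<H> \<Longrightarrow> \<exists>s\<in>S. inv s \<otimes> h \<otimes> s \<in> H'"
    using URS_finitely_many_conjugates[OF U H(1,2)] by (elim exE conjE) (rule that, auto)
  define C where "C = (\<lambda>k. {g \<in> carrier G. \<forall>N. finite_index_normal N G \<longrightarrow> inv g \<otimes> k \<otimes> g \<in> H <#> N})"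
  have cover: "carrier G \<subseteq> (\<Union>s\<in>S. C (inv s \<otimes> h \<otimes> s))"
  proof
    fix g assume g: "g \<in> carrier G"
    have "conj_action G g H \<in> \<H>" using U g H(1) by (auto simp: URS_def)
    then obtain s where s: "s \<in> S" "inv s \<otimes> h \<otimes> s \<in> conj_action G g H" using S(3) by blast
    then have "inv g \<otimes> (inv s \<otimes> h \<otimes> s) \<otimes> g \<in> H"
      using mem_conj_action_iff[OF sH g] S(2) h by auto
    then have "g \<in> C (inv s \<otimes> h \<otimes> s)"
      using g subgroup_mult_normal(2)[OF sH finite_index_normalD(1)] by (auto simp: C_def)
    then show "g \<in> (\<Union>s\<in>S. C (inv s \<otimes> h \<otimes> s))" using s(1) by blast
  qed
  have "\<exists>D\<in>(\<lambda>s. C (inv s \<otimes> h \<otimes> s)) ` S. \<exists>V. openin (profinite_topology G) V \<and> V \<noteq> {} \<and> V \<subseteq> D"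
  proof (rule finite_closed_cover_has_interior)
    show "openin (profinite_topology G) (carrier G)"
      using openin_topspace[of "profinite_topology G"] by (simp add: topspace_profinite_topology)
    show "closedin (profinite_topology G) D" if "D \<in> (\<lambda>s. C (inv s \<otimes> h \<otimes> s)) ` S" for D
      using that S(2) h closedin_conjugators_into_closure[OF sH] by (auto simp: C_def)
  qed (use S(1) cover in auto)
  then obtain s V where s: "s \<in> S" and V: "openin (profinite_topology G) V" "V \<noteq> {}"
    "V \<subseteq> C (inv s \<otimes> h \<otimes> s)" by blast
  then obtain t where t: "t \<in> V" by blast
  then obtain N where N: "finite_index_normal N G" "t <# N \<subseteq> V"
    using V(1) unfolding openin_profinite_topology_iff by blast
  have sc: "s \<in> carrier G" using s S(2) by blast
  have "h = s \<otimes> (inv s \<otimes> h \<otimes> s) \<otimes> inv s" using sc h by (simp add: m_assoc mult_inv_cancel_left)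
  then have "inv s \<otimes> h \<otimes> s \<noteq> \<one>" using H(3) sc by auto
  moreover have "inv s \<otimes> h \<otimes> s \<in> carrier G" using sc h by simp
  moreover have "t \<in> carrier G" using t V(3) by (auto simp: C_def)
  moreover have "\<forall>g\<in>t <# N. \<forall>M. finite_index_normal M G \<longrightarrow>
      inv g \<otimes> (inv s \<otimes> h \<otimes> s) \<otimes> g \<in> H <#> M"
    using N(2) V(3) by (auto simp: C_def)
  ultimately show ?thesis using N(1) by blast
qed

end

section \<open>Inverse limits of coset spaces\<close>

text \<open>
  The inverse limit of the discrete spaces \<open>G/K\<close>. A point is a compatible choice of a coset of each
  \<open>K \<in> \<K>\<close>. The subgroups themselves serve as index set, so that the bonding maps \<open>G/K \<rightarrow> G/L\<close> for
  \<open>K \<subseteq> L\<close> become inclusions between the chosen cosets.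
\<close>

definition coset_limit :: "('a, 'm) monoid_scheme \<Rightarrow> 'a set set \<Rightarrow> ('a set \<Rightarrow> 'a set) topology" where
  "coset_limit G \<K> =
     subtopology
       (product_topology (\<lambda>K. discrete_topology {g <#\<^bsub>G\<^esub> K |g. g \<in> carrier G}) \<K>)
       {y. \<forall>K\<in>\<K>. \<forall>L\<in>\<K>. K \<subseteq> L \<longrightarrow> y K \<subseteq> y L}"

definition translation ::
  "('a, 'm) monoid_scheme \<Rightarrow> 'a set set \<Rightarrow> 'a \<Rightarrow> ('a set \<Rightarrow> 'a set) \<Rightarrow> ('a set \<Rightarrow> 'a set)" where
  "translation G \<K> g = (\<lambda>y\<in>topspace (coset_limit G \<K>). \<lambda>K\<in>\<K>. g <#\<^bsub>G\<^esub> y K)"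

lemma group_actionI:
  assumes "group G"
    and closed: "\<And>g x. g \<in> carrier G \<Longrightarrow> x \<in> E \<Longrightarrow> \<phi> g x \<in> E"
    and ext: "\<And>g. g \<in> carrier G \<Longrightarrow> \<phi> g \<in> extensional E"
    and one: "\<And>x. x \<in> E \<Longrightarrow> \<phi> \<one>\<^bsub>G\<^esub> x = x"
    and mult: "\<And>a b x. a \<in> carrier G \<Longrightarrow> b \<in> carrier G \<Longrightarrow> x \<in> E \<Longrightarrow>
      \<phi> (a \<otimes>\<^bsub>G\<^esub> b) x = \<phi> a (\<phi> b x)"
  shows "group_action G E \<phi>"
proof -
  interpret group G by (rule assms(1))
  have inverse: "\<phi> (inv\<^bsub>G\<^esub> g) (\<phi> g x) = x" "\<phi> g (\<phi> (inv\<^bsub>G\<^esub> g) x) = x"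
    if "g \<in> carrier G" "x \<in> E" for g x
    using that mult[of "inv\<^bsub>G\<^esub> g" g x] mult[of g "inv\<^bsub>G\<^esub> g" x] one by auto
  have bij: "\<phi> g \<in> Bij E" if g: "g \<in> carrier G" for g
  proof -
    have "bij_betw (\<phi> g) E E"
      using g inverse closed by (intro bij_betwI[where g = "\<phi> (inv\<^bsub>G\<^esub> g)"]) auto
    then show ?thesis using ext[OF g] by (simp add: Bij_def)
  qed
  show ?thesis
    unfolding group_action_def group_hom_def group_hom_axioms_def
  proof (intro conjI homI)
    show "group G" by (rule is_group)
    show "group (BijGroup E)" by (rule group_BijGroup)
    show "\<phi> g \<in> carrier (BijGroup E)" if "g \<in> carrier G" for g
      using bij[OF that] by (simp add: BijGroup_def)
    show "\<phi> (a \<otimes>\<^bsub>G\<^esub> b) = \<phi> a \<otimes>\<^bsub>BijGroup E\<^esub> \<phi> b"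
      if ab: "a \<in> carrier G" "b \<in> carrier G" for a b
    proof -
      have "\<phi> (a \<otimes>\<^bsub>G\<^esub> b) = compose E (\<phi> a) (\<phi> b)"
        by (rule extensionalityI[of _ E]) (use ab ext mult in \<open>auto simp: compose_def\<close>)
      then show ?thesis using ab bij by (simp add: BijGroup_def)
    qed
  qed
qed

text \<open>
  The subgroups containing a normal subgroup of finite index are exactly those that are open for the
  profinite topology.
\<close>

locale profinitely_open_subgroups = group G for G :: "('a, 'm) monoid_scheme" (structure) +
  fixes \<K> :: "'a set set"
  assumes nonempty: "\<K> \<noteq> {}"
    and subgroups: "K \<in> \<K> \<Longrightarrow> subgroup K G"
    and contains_normal: "K \<in> \<K> \<Longrightarrow> \<exists>N. finite_index_normal N G \<and> N \<subseteq> K"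
    and directed: "K \<in> \<K> \<Longrightarrow> L \<in> \<K> \<Longrightarrow> \<exists>M\<in>\<K>. M \<subseteq> K \<and> M \<subseteq> L"
begin

abbreviation Y where "Y \<equiv> coset_limit G \<K>"
abbreviation \<tau> where "\<tau> \<equiv> translation G \<K>"

lemma mem_coset_limit_iff:
  "y \<in> topspace Y \<longleftrightarrow> y \<in> extensional \<K> \<and> (\<forall>K\<in>\<K>. \<exists>g\<in>carrier G. y K = g <# K) \<and>
     (\<forall>K\<in>\<K>. \<forall>L\<in>\<K>. K \<subseteq> L \<longrightarrow> y K \<subseteq> y L)"
  by (auto simp: coset_limit_def PiE_iff) blast+

lemma coset_limitE:
  assumes "y \<in> topspace Y" "K \<in> \<K>"
  obtains g where "g \<in> carrier G" "y K = g <# K"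
  using assms unfolding mem_coset_limit_iff by blast

lemma representative_mem: "K \<in> \<K> \<Longrightarrow> g \<in> carrier G \<Longrightarrow> g \<in> g <# K"
  using subgroup.one_closed[OF subgroups] by (force simp: l_coset_def)

lemma coset_eqI: "K \<in> \<K> \<Longrightarrow> g \<in> carrier G \<Longrightarrow> x \<in> g <# K \<Longrightarrow> x <# K = g <# K"
  using l_coset_repr_eq[OF subgroups] by blast

lemma coset_mult:
  "K \<in> \<K> \<Longrightarrow> a \<in> carrier G \<Longrightarrow> b \<in> carrier G \<Longrightarrow> a <# (b <# K) = a \<otimes> b <# K"
  using lcos_m_assoc[OF subgroup.subset[OF subgroups]] by blast

text \<open>
  Compatible cosets are determined by any representative at a lower level.
\<close>

lemma coset_value:
  assumes "y \<in> topspace Y" "K \<in> \<K>" "L \<in> \<K>" "K \<subseteq> L" "g \<in> carrier G" "g \<in> y K"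
  shows "y L = g <# L"
proof -
  obtain b where b: "b \<in> carrier G" "y L = b <# L" using coset_limitE[OF assms(1,3)] .
  have "g \<in> y L" using assms unfolding mem_coset_limit_iff by blast
  then show ?thesis using coset_eqI[OF assms(3) b(1)] b(2) by simp
qed

lemma coset_agree:
  assumes "y \<in> topspace Y" "z \<in> topspace Y" "K \<in> \<K>" "L \<in> \<K>" "K \<subseteq> L" "y K = z K"
  shows "y L = z L"
proof -
  obtain g where g: "g \<in> carrier G" "y K = g <# K" using coset_limitE[OF assms(1,3)] .
  then have "g \<in> y K" "g \<in> z K" using representative_mem[OF assms(3)] assms(6) by auto
  then show ?thesis using coset_value assms g(1) by metis
qed

lemma basepoint: "(\<lambda>K\<in>\<K>. \<one> <# K) \<in> topspace Y"
  unfolding mem_coset_limit_iff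
proof (intro conjI ballI impI)
  show "\<exists>g\<in>carrier G. (\<lambda>K\<in>\<K>. \<one> <# K) K = g <# K" if "K \<in> \<K>" for K
    using that by (intro bexI[of _ \<one>]) simp_all
  show "(\<lambda>K\<in>\<K>. \<one> <# K) K \<subseteq> (\<lambda>K\<in>\<K>. \<one> <# K) L" if "K \<in> \<K>" "L \<in> \<K>" "K \<subseteq> L" for K L
    using that by (auto simp: l_coset_def)
qed simp

lemma continuous_coordinate:
  "K \<in> \<K> \<Longrightarrow> continuous_map Y (discrete_topology {g <# K |g. g \<in> carrier G}) (\<lambda>y. y K)"
  unfolding coset_limit_def
  by (intro continuous_map_from_subtopology continuous_map_product_projection)

lemma openin_cylinder: "K \<in> \<K> \<Longrightarrow> openin Y {y \<in> topspace Y. y K \<in> B}"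
proof -
  assume K: "K \<in> \<K>"
  have "openin Y {y \<in> topspace Y. y K \<in> B \<inter> {g <# K |g. g \<in> carrier G}}"
    by (rule openin_continuous_map_preimage[OF continuous_coordinate[OF K]]) auto
  moreover have "{y \<in> topspace Y. y K \<in> B \<inter> {g <# K |g. g \<in> carrier G}} = {y \<in> topspace Y. y K \<in> B}"
    using K coset_limitE by blast
  ultimately show ?thesis by simp
qed

lemma directed_finite:
  assumes "finite \<F>" "\<F> \<subseteq> \<K>"
  shows "\<exists>M\<in>\<K>. \<forall>K\<in>\<F>. M \<subseteq> K"
  using assms
proof (induction rule: finite_induct)
  case empty
  then show ?case using nonempty by auto
next
  case (insert K \<F>)
  then obtain M where M: "M \<in> \<K>" "\<forall>K\<in>\<F>. M \<subseteq> K" by auto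
  obtain M' where "M' \<in> \<K>" "M' \<subseteq> K" "M' \<subseteq> M" using directed[of K M] insert.prems M(1) by auto
  then show ?case using M(2) by (intro bexI[of _ M']) auto
qed

text \<open>Since \<open>\<K>\<close> is directed, a single coordinate suffices to describe basic neighbourhoods.\<close>

lemma cylinder_neighbourhood:
  assumes "openin Y W" "y \<in> W"
  shows "\<exists>K\<in>\<K>. {z \<in> topspace Y. z K = y K} \<subseteq> W"
proof -
  let ?Q = "\<lambda>K. discrete_topology {g <# K |g. g \<in> carrier G}"
  let ?R = "{y. \<forall>K\<in>\<K>. \<forall>L\<in>\<K>. K \<subseteq> L \<longrightarrow> y K \<subseteq> y L}"
  obtain T where T: "openin (product_topology ?Q \<K>) T" "W = T \<inter> ?R"
    using assms(1) unfolding coset_limit_def openin_subtopology by blast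
  have y: "y \<in> T" "y \<in> topspace Y" using assms T openin_subset[OF assms(1)] by auto
  obtain U where U: "finite {K \<in> \<K>. U K \<noteq> topspace (?Q K)}" "y \<in> Pi\<^sub>E \<K> U" "Pi\<^sub>E \<K> U \<subseteq> T"
    using openin_product_topology_alt[THEN iffD1, rule_format, OF T(1) y(1)]
    by (elim exE conjE) (rule that)
  obtain M where M: "M \<in> \<K>" "\<forall>K\<in>{K \<in> \<K>. U K \<noteq> topspace (?Q K)}. M \<subseteq> K"
    using directed_finite[OF U(1)] by auto
  have "{z \<in> topspace Y. z M = y M} \<subseteq> W"
  proof
    fix z assume "z \<in> {z \<in> topspace Y. z M = y M}"
    then have z: "z \<in> topspace Y" "z M = y M" by auto
    have "z K \<in> U K" if K: "K \<in> \<K>" for K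
    proof (cases "U K = topspace (?Q K)")
      case True
      obtain g where "g \<in> carrier G" "z K = g <# K" using coset_limitE[OF z(1) K] .
      then show ?thesis using True by auto
    next
      case False
      then have "z K = y K" using coset_agree[OF z(1) y(2) M(1) K] M(2) K z(2) by auto
      then show ?thesis using U(2) K by auto
    qed
    then have "z \<in> Pi\<^sub>E \<K> U" using z(1) by (auto simp: mem_coset_limit_iff PiE_iff)
    moreover have "z \<in> ?R" using z(1) by (auto simp: mem_coset_limit_iff)
    ultimately show "z \<in> W" using U(3) T(2) by blast
  qed
  then show ?thesis using M(1) by blast
qed

lemma finite_cosets:
  assumes "K \<in> \<K>"
  shows "finite {g <# K |g. g \<in> carrier G}"
proof -
  obtain N where N: "finite_index_normal N G" "N \<subseteq> K" using contains_normal[OF assms] by blast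
  interpret N: normal N G using N(1) by (simp add: finite_index_normal_def)
  interpret K: subgroup K G by (rule subgroups[OF assms])
  have "N <#> K = K"
  proof
    show "N <#> K \<subseteq> K" using N(2) by (auto simp: set_mult_def)
    have "x \<in> N <#> K" if "x \<in> K" for x
    proof -
      have "x = \<one> \<otimes> x" using that K.mem_carrier by simp
      then show ?thesis using that N.one_closed unfolding set_mult_def by blast
    qed
    then show "K \<subseteq> N <#> K" by blast
  qed
  then have "g <# K = (N #> g) <#> K" if "g \<in> carrier G" for g
    using that setmult_lcos_assoc[OF N.subset subgroup.subset[OF subgroups[OF assms]] that]
      N.coset_eq by simp
  then have "{g <# K |g. g \<in> carrier G} \<subseteq> (\<lambda>C. C <#> K) ` (rcosets N)"
    by (auto simp: RCOSETS_def)
  then show ?thesis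
    using N(1) finite_surj by (auto simp: finite_index_normal_def)
qed

text \<open>
  The factors are finite, and incompatibility of a family of cosets is already visible in two
  coordinates.
\<close>

lemma compact_coset_limit: "compact_space Y"
proof -
  let ?Q = "\<lambda>K. discrete_topology {g <# K |g. g \<in> carrier G}"
  let ?P = "product_topology ?Q \<K>"
  let ?A = "\<lambda>K c. {y \<in> topspace ?P. y K \<in> {c}}"
  have comp: "compact_space ?P"
    using finite_cosets by (simp add: compact_space_product_topology compact_space_discrete_topology)
  have op: "openin ?P (?A K c)" if "K \<in> \<K>" "c \<in> topspace (?Q K)" for K c
    using that by (intro openin_continuous_map_preimage[OF continuous_map_product_projection]) auto
  have "openin ?P (topspace ?P - topspace Y)"
  proof (subst openin_subopen, intro ballI)
    fix y assume y: "y \<in> topspace ?P - topspace Y"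
    then obtain K L where KL: "K \<in> \<K>" "L \<in> \<K>" "K \<subseteq> L" "\<not> y K \<subseteq> y L"
      by (auto simp: coset_limit_def)
    have "openin ?P (?A K (y K) \<inter> ?A L (y L))"
      using y KL by (intro openin_Int op) (auto simp: PiE_iff)
    moreover have "y \<in> ?A K (y K) \<inter> ?A L (y L)" using y by simp
    moreover have "?A K (y K) \<inter> ?A L (y L) \<subseteq> topspace ?P - topspace Y"
    proof
      fix z assume z: "z \<in> ?A K (y K) \<inter> ?A L (y L)"
      have "z K \<subseteq> z L" if "z \<in> topspace Y"
        using that KL(1-3) unfolding mem_coset_limit_iff by blast
      then have "z \<notin> topspace Y" using z KL(4) by auto
      then show "z \<in> topspace ?P - topspace Y" using z by simp
    qed
    ultimately show "\<exists>T. openin ?P T \<and> y \<in> T \<and> T \<subseteq> topspace ?P - topspace Y" by blast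
  qed
  then have "closedin ?P (topspace Y)"
    by (simp add: closedin_def coset_limit_def)
  then have "compactin ?P (topspace Y)" by (rule closedin_compact_space[OF comp])
  then show ?thesis
    using subtopology_restrict[of ?P "{y. \<forall>K\<in>\<K>. \<forall>L\<in>\<K>. K \<subseteq> L \<longrightarrow> y K \<subseteq> y L}"]
    by (simp add: compactin_subspace coset_limit_def)
qed

lemma eq_coset_limit_iff:
  assumes "y \<in> topspace Y" "z \<in> topspace Y"
  shows "y = z \<longleftrightarrow> (\<forall>K\<in>\<K>. y K = z K)"
  using assms by (auto simp: mem_coset_limit_iff intro: extensionalityI)

lemma Hausdorff_coset_limit: "Hausdorff_space Y"
  unfolding coset_limit_def
  by (intro Hausdorff_space_subtopology) (simp add: Hausdorff_space_product_topology)

lemma totally_disconnected_coset_limit: "totally_disconnected Y"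
  unfolding totally_disconnected_def
proof (intro allI impI)
  fix S assume S: "connectedin Y S"
  have SY: "S \<subseteq> topspace Y" by (rule connectedin_subset_topspace[OF S])
  have coord: "y K = z K" if yz: "y \<in> S" "z \<in> S" and K: "K \<in> \<K>" for y z K
  proof -
    have "connectedin (discrete_topology {g <# K |g. g \<in> carrier G}) ((\<lambda>y. y K) ` S)"
      using continuous_coordinate[OF K] S by (rule connectedin_continuous_map_image)
    then obtain a where "(\<lambda>y. y K) ` S \<subseteq> {a}" by (auto simp: connectedin_discrete_topology)
    then have "y K = a" "z K = a" using yz by auto
    then show ?thesis by simp
  qed
  have eq: "y = z" if "y \<in> S" "z \<in> S" for y z
  proof -
    have "y \<in> topspace Y" "z \<in> topspace Y" using SY that by auto
    then show ?thesis using eq_coset_limit_iff coord[OF that] by simp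
  qed
  show "\<exists>a. S \<subseteq> {a}"
  proof (cases "S = {}")
    case False
    then obtain a where "a \<in> S" by blast
    then have "S \<subseteq> {a}" using eq by blast
    then show ?thesis by blast
  qed simp
qed

lemma translation_apply:
  "y \<in> topspace Y \<Longrightarrow> K \<in> \<K> \<Longrightarrow> \<tau> g y K = g <# y K"
  by (simp add: translation_def)

lemma translation_closed:
  assumes g: "g \<in> carrier G" and y: "y \<in> topspace Y"
  shows "\<tau> g y \<in> topspace Y"
proof -
  have "\<tau> g y \<in> extensional \<K>" using y by (simp add: translation_def)
  moreover have "\<exists>b\<in>carrier G. \<tau> g y K = b <# K" if K: "K \<in> \<K>" for K
  proof -
    obtain b where "b \<in> carrier G" "y K = b <# K" using coset_limitE[OF y K] .
    then have "\<tau> g y K = g \<otimes> b <# K" using translation_apply[OF y K] coset_mult K g by simp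
    then show ?thesis using \<open>b \<in> carrier G\<close> g by (intro bexI[of _ "g \<otimes> b"]) simp_all
  qed
  moreover have "\<tau> g y K \<subseteq> \<tau> g y L" if KL: "K \<in> \<K>" "L \<in> \<K>" "K \<subseteq> L" for K L
  proof -
    have "y K \<subseteq> y L" using y KL unfolding mem_coset_limit_iff by blast
    then show ?thesis using translation_apply[OF y] KL by (auto simp: l_coset_def)
  qed
  ultimately show ?thesis unfolding mem_coset_limit_iff by blast
qed

lemma translation_one: "y \<in> topspace Y \<Longrightarrow> \<tau> \<one> y = y"
proof -
  assume y: "y \<in> topspace Y"
  have "\<tau> \<one> y K = y K" if K: "K \<in> \<K>" for K
  proof -
    obtain b where "b \<in> carrier G" "y K = b <# K" using coset_limitE[OF y K] .
    then show ?thesis using translation_apply[OF y K] coset_mult[OF K] by simp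
  qed
  then show ?thesis using eq_coset_limit_iff[OF translation_closed[OF one_closed y] y] by simp
qed

lemma translation_mult:
  assumes "a \<in> carrier G" "b \<in> carrier G" and y: "y \<in> topspace Y"
  shows "\<tau> (a \<otimes> b) y = \<tau> a (\<tau> b y)"
proof -
  note bY = translation_closed[OF assms(2) y]
  have "\<tau> (a \<otimes> b) y K = \<tau> a (\<tau> b y) K" if K: "K \<in> \<K>" for K
  proof -
    obtain c where "c \<in> carrier G" "y K = c <# K" using coset_limitE[OF y K] .
    then show ?thesis
      using assms K by (simp add: translation_apply bY coset_mult m_assoc)
  qed
  then show ?thesis
    using eq_coset_limit_iff translation_closed[OF m_closed[OF assms(1,2)] y]
      translation_closed[OF assms(1) bY] by simp
qed

lemma group_action_translation: "group_action G (topspace Y) \<tau>"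
proof (rule group_actionI)
  show "\<tau> g \<in> extensional (topspace Y)" for g by (simp add: translation_def)
qed (use is_group translation_closed translation_one translation_mult in auto)

lemma continuous_translation:
  assumes g: "g \<in> carrier G"
  shows "continuous_map Y Y (\<tau> g)"
  unfolding continuous_map_def
proof (intro conjI allI impI)
  show "\<tau> g \<in> topspace Y \<rightarrow> topspace Y" using translation_closed[OF g] by auto
  fix W assume W: "openin Y W"
  show "openin Y {y \<in> topspace Y. \<tau> g y \<in> W}"
  proof (subst openin_subopen, intro ballI)
    fix y assume "y \<in> {y \<in> topspace Y. \<tau> g y \<in> W}"
    then have y: "y \<in> topspace Y" "\<tau> g y \<in> W" by auto
    obtain K where K: "K \<in> \<K>" "{z \<in> topspace Y. z K = \<tau> g y K} \<subseteq> W"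
      using cylinder_neighbourhood[OF W y(2)] by blast
    have "openin Y {z \<in> topspace Y. z K \<in> {y K}}" by (rule openin_cylinder[OF K(1)])
    moreover have "{z \<in> topspace Y. z K \<in> {y K}} \<subseteq> {y \<in> topspace Y. \<tau> g y \<in> W}"
    proof
      fix z assume "z \<in> {z \<in> topspace Y. z K \<in> {y K}}"
      then have z: "z \<in> topspace Y" "z K = y K" by auto
      then have "\<tau> g z K = \<tau> g y K" using translation_apply K(1) y(1) by simp
      then have "\<tau> g z \<in> W" using K(2) translation_closed[OF g z(1)] by blast
      then show "z \<in> {y \<in> topspace Y. \<tau> g y \<in> W}" using z(1) by simp
    qed
    ultimately show "\<exists>T. openin Y T \<and> y \<in> T \<and> T \<subseteq> {y \<in> topspace Y. \<tau> g y \<in> W}"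
      using y(1) by (intro exI[of _ "{z \<in> topspace Y. z K \<in> {y K}}"]) simp
  qed
qed

lemma compact_G_space_coset_limit: "compact_G_space G Y \<tau>"
  unfolding compact_G_space_def G_space_def
proof (intro conjI ballI)
  show "topspace Y \<noteq> {}" using basepoint by blast
  fix g assume g: "g \<in> carrier G"
  have "\<tau> (inv g) (\<tau> g y) = y" "\<tau> g (\<tau> (inv g) y) = y" if "y \<in> topspace Y" for y
    using translation_mult[OF inv_closed[OF g] g that] translation_mult[OF g inv_closed[OF g] that]
      translation_one[OF that] g by simp_all
  then have "homeomorphic_maps Y Y (\<tau> g) (\<tau> (inv g))"
    using continuous_translation g by (simp add: homeomorphic_maps_def)
  then show "homeomorphic_map Y Y (\<tau> g)" using homeomorphic_map_maps by blast
qed (use group_action_translation compact_coset_limit Hausdorff_coset_limit in auto)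

text \<open>
  A neighbourhood contains a cylinder over one coordinate, and \<open>G\<close> is transitive on that coordinate.
\<close>

lemma minimal_coset_limit: "minimal_on G Y \<tau>"
  unfolding minimal_on_def
proof (intro ballI Set.equalityI closure_of_subset_topspace subsetI)
  fix y z assume y: "y \<in> topspace Y" and z: "z \<in> topspace Y"
  have "\<exists>x. x \<in> orbit G \<tau> y \<and> x \<in> W" if W: "openin Y W" "z \<in> W" for W
  proof -
    obtain K where K: "K \<in> \<K>" "{x \<in> topspace Y. x K = z K} \<subseteq> W"
      using cylinder_neighbourhood[OF W] by blast
    obtain a where a: "a \<in> carrier G" "z K = a <# K" using coset_limitE[OF z K(1)] .
    obtain b where b: "b \<in> carrier G" "y K = b <# K" using coset_limitE[OF y K(1)] .
    let ?g = "a \<otimes> inv b"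
    have g: "?g \<in> carrier G" using a b by simp
    have "\<tau> ?g y K = ?g \<otimes> b <# K" using translation_apply[OF y K(1)] coset_mult[OF K(1) g b(1)] b(2) by simp
    also have "?g \<otimes> b = a" using a b by (simp add: m_assoc)
    finally have "\<tau> ?g y \<in> W" using a(2) K(2) translation_closed[OF g y] by auto
    moreover have "\<tau> ?g y \<in> orbit G \<tau> y" using g unfolding orbit_def by blast
    ultimately show ?thesis by blast
  qed
  then show "z \<in> Y closure_of orbit G \<tau> y" using z by (auto simp: in_closure_of)
qed

text \<open>
  Finitely many cylinders inside \<open>U\<close> cover \<open>U\<close> by compactness, and directedness merges their coordinates.
\<close>

lemma clopen_determined_by_coordinate:
  assumes "openin Y U" "closedin Y U"
  shows "\<exists>K\<in>\<K>. \<forall>y\<in>U. \<forall>z\<in>topspace Y. z K = y K \<longrightarrow> z \<in> U"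
proof -
  have "\<exists>K. \<forall>y\<in>U. K y \<in> \<K> \<and> {z \<in> topspace Y. z (K y) = y (K y)} \<subseteq> U"
    using cylinder_neighbourhood[OF assms(1)] by (intro bchoice) blast
  then obtain \<kappa> where \<kappa>: "\<And>y. y \<in> U \<Longrightarrow> \<kappa> y \<in> \<K>"
    "\<And>y z. y \<in> U \<Longrightarrow> z \<in> topspace Y \<Longrightarrow> z (\<kappa> y) = y (\<kappa> y) \<Longrightarrow> z \<in> U" by blast
  let ?C = "\<lambda>y. {z \<in> topspace Y. z (\<kappa> y) \<in> {y (\<kappa> y)}}"
  have UY: "U \<subseteq> topspace Y" using openin_subset[OF assms(1)] .
  have "compactin Y U" by (rule closedin_compact_space[OF compact_coset_limit assms(2)])
  moreover have "\<forall>V\<in>?C ` U. openin Y V" using openin_cylinder \<kappa>(1) by blast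
  moreover have "U \<subseteq> \<Union>(?C ` U)" using UY by auto
  ultimately obtain \<F> where \<F>: "finite \<F>" "\<F> \<subseteq> ?C ` U" "U \<subseteq> \<Union>\<F>"
    unfolding compactin_def by meson
  obtain F where F: "F \<subseteq> U" "finite F" "\<F> = ?C ` F"
    using finite_subset_image[OF \<F>(1,2)] by (elim exE conjE) (rule that)
  obtain M where M: "M \<in> \<K>" "\<forall>K\<in>\<kappa> ` F. M \<subseteq> K"
    using directed_finite[of "\<kappa> ` F"] F \<kappa>(1) by auto
  have "z \<in> U" if y: "y \<in> U" and z: "z \<in> topspace Y" "z M = y M" for y z
  proof -
    obtain x where x: "x \<in> F" "y (\<kappa> x) = x (\<kappa> x)" using \<F>(3) F(3) y by auto
    have "z (\<kappa> x) = y (\<kappa> x)"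
    proof (rule coset_agree[where K = M and L = "\<kappa> x" and y = z and z = y])
      show "\<kappa> x \<in> \<K>" using x(1) F(1) \<kappa>(1) by blast
    qed (use z y UY M x(1) in auto)
    then show "z \<in> U" using \<kappa>(2)[of x z] x F(1) z(1) by auto
  qed
  then show ?thesis using M(1) by blast
qed

text \<open>
  A clopen set is determined by one coordinate \<open>K\<close>. A normal subgroup inside \<open>K\<close> acts trivially on the
  cosets of \<open>K\<close>, so the stabilizer of the clopen set contains it and is a union of its cosets.
\<close>

lemma profinite_coset_limit: "profinite_G_space G Y \<tau>"
  unfolding profinite_G_space_def
proof (intro conjI allI impI; (elim conjE)?)
  fix U assume U: "openin Y U" "closedin Y U"
  have UY: "U \<subseteq> topspace Y" using openin_subset[OF U(1)] .
  obtain K where K: "K \<in> \<K>" "\<And>y z. y \<in> U \<Longrightarrow> z \<in> topspace Y \<Longrightarrow> z K = y K \<Longrightarrow> z \<in> U"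
    using clopen_determined_by_coordinate[OF U] by blast
  obtain N where N: "finite_index_normal N G" "N \<subseteq> K" using contains_normal[OF K(1)] by blast
  interpret N: normal N G using N(1) by (simp add: finite_index_normal_def)
  have fix_coord: "\<tau> n y K = y K" if nN: "n \<in> N" and yY: "y \<in> topspace Y" for n y
  proof -
    obtain b where b: "b \<in> carrier G" "y K = b <# K" using coset_limitE[OF yY K(1)] .
    have n: "n \<in> carrier G" using nN N.mem_carrier by simp
    have "inv b \<otimes> n \<otimes> b \<in> K" using N.inv_op_closed1[OF b(1) nN] N(2) by blast
    moreover have "b \<otimes> (inv b \<otimes> n \<otimes> b) = n \<otimes> b" using b n by (simp add: m_assoc mult_inv_cancel_left)
    ultimately have "n \<otimes> b \<in> b <# K" unfolding l_coset_def by force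
    then have "n \<otimes> b <# K = b <# K" by (rule coset_eqI[OF K(1) b(1)])
    then show ?thesis using translation_apply[OF yY K(1)] coset_mult[OF K(1) n b(1)] b(2) by simp
  qed
  have img: "\<tau> n ` U = U" if n: "n \<in> N" for n
  proof -
    have sub: "\<tau> m ` U \<subseteq> U" if "m \<in> N" for m
    proof
      fix z assume "z \<in> \<tau> m ` U"
      then obtain y where y: "y \<in> U" "z = \<tau> m y" by blast
      have "m \<in> carrier G" using that N.mem_carrier by simp
      then show "z \<in> U"
        using K(2)[OF y(1)] translation_closed fix_coord[OF that] y UY by auto
    qed
    have "y \<in> \<tau> n ` U" if "y \<in> U" for y
    proof -
      have nc: "n \<in> carrier G" using n N.mem_carrier by simp
      have y: "y \<in> topspace Y" using that UY by blast
      have "y = \<tau> n (\<tau> (inv n) y)"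
        using translation_mult[OF nc inv_closed[OF nc] y] translation_one[OF y] nc by simp
      moreover have "\<tau> (inv n) y \<in> U" using sub[OF N.m_inv_closed[OF n]] that by blast
      ultimately show ?thesis by blast
    qed
    then show ?thesis using sub[OF n] by blast
  qed
  show "openin (profinite_topology G) {g \<in> carrier G. \<tau> g ` U = U}"
    unfolding openin_profinite_topology_iff
  proof (intro conjI ballI exI[of _ N] subsetI N(1))
    fix g x assume g: "g \<in> {g \<in> carrier G. \<tau> g ` U = U}" and "x \<in> g <# N"
    then obtain n where n: "n \<in> N" "x = g \<otimes> n" by (auto simp: l_coset_def)
    have nc: "n \<in> carrier G" using n N.mem_carrier by simp
    have "\<tau> x ` U = \<tau> g ` (\<tau> n ` U)"
      unfolding n(2) image_image using g nc UY translation_mult by (intro image_cong) auto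
    then show "x \<in> {g \<in> carrier G. \<tau> g ` U = U}" using g n nc img by simp
  qed simp
qed (use compact_G_space_coset_limit totally_disconnected_coset_limit in auto)

text \<open>
  The condition on \<open>g\<close> and \<open>K\<close> says that \<open>k\<close> fixes the coset \<open>gK\<close>. Hence \<open>k\<close> fixes every point of the
  cylinder over the coset \<open>tL\<close>.
\<close>

lemma not_topologically_free_coset_limit:
  assumes k: "k \<in> carrier G" "k \<noteq> \<one>" and t: "t \<in> carrier G" and L: "L \<in> \<K>"
    and conj: "\<And>g K. g \<in> t <# L \<Longrightarrow> K \<in> \<K> \<Longrightarrow> inv g \<otimes> k \<otimes> g \<in> K"
  shows "\<not> topologically_free G Y \<tau>"
proof
  let ?y = "\<tau> t (\<lambda>K\<in>\<K>. \<one> <# K)"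
  let ?W = "{z \<in> topspace Y. z L \<in> {t <# L}}"
  assume free: "topologically_free G Y \<tau>"
  have y: "?y \<in> topspace Y" by (rule translation_closed[OF t basepoint])
  have "?y L = t <# L" using translation_apply[OF basepoint L] coset_mult[OF L t] L t by simp
  then have "?y \<in> ?W" using y by simp
  moreover have "openin Y ?W" by (rule openin_cylinder[OF L])
  moreover have "\<tau> k z = z" if z: "z \<in> ?W" for z
  proof -
    have zY: "z \<in> topspace Y" and zL: "z L = t <# L" using z by auto
    have "\<tau> k z K = z K" if K: "K \<in> \<K>" for K
    proof -
      \<comment> \<open>A representative of \<open>z\<close> at a level below \<open>K\<close> and \<open>L\<close> represents \<open>z\<close> at both.\<close>
      obtain M where M: "M \<in> \<K>" "M \<subseteq> K" "M \<subseteq> L" using directed[OF K L] by blast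
      obtain g where g: "g \<in> carrier G" "z M = g <# M" using coset_limitE[OF zY M(1)] .
      have gM: "g \<in> z M" using representative_mem[OF M(1) g(1)] g(2) by simp
      have zK: "z K = g <# K" by (rule coset_value[OF zY M(1) K M(2) g(1) gM])
      have "z L = g <# L" by (rule coset_value[OF zY M(1) L M(3) g(1) gM])
      then have "g \<in> t <# L" using representative_mem[OF L g(1)] zL by simp
      then have "inv g \<otimes> k \<otimes> g \<in> K" using conj K by simp
      moreover have "g \<otimes> (inv g \<otimes> k \<otimes> g) = k \<otimes> g" using g k by (simp add: m_assoc mult_inv_cancel_left)
      ultimately have "k \<otimes> g \<in> g <# K" unfolding l_coset_def by force
      then have "k \<otimes> g <# K = g <# K" by (rule coset_eqI[OF K g(1)])
      then show ?thesis using translation_apply[OF zY K] coset_mult[OF K k(1) g(1)] zK by simp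
    qed
    then show ?thesis using eq_coset_limit_iff[OF translation_closed[OF k(1) zY] zY] by simp
  qed
  ultimately have "k = \<one>" using free y k(1) unfolding topologically_free_def by blast
  then show False using k(2) by simp
qed

text \<open>
  The stabilizer of the base point, the family of the subgroups \<open>K\<close> themselves, is the intersection of \<open>\<K>\<close>.
\<close>

lemma kernel_coset_limit:
  assumes "m \<in> kernel G (BijGroup (topspace Y)) \<tau>" "K \<in> \<K>"
  shows "m \<in> K"
proof -
  let ?y = "\<lambda>K\<in>\<K>. \<one> <# K"
  have m: "m \<in> carrier G" "\<tau> m ?y = ?y"
    using assms(1) basepoint by (auto simp: kernel_def BijGroup_def)
  have "\<tau> m ?y K = m <# K"
    using translation_apply[OF basepoint assms(2)] coset_mult[OF assms(2) m(1) one_closed] assms(2) m(1)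
    by simp
  then have "m <# K = \<one> <# K" using m(2) assms(2) by simp
  then have "m \<in> \<one> <# K" using representative_mem[OF assms(2) m(1)] by simp
  then show ?thesis
    using subgroup.mem_carrier[OF subgroups[OF assms(2)]] by (auto simp: l_coset_def)
qed

text \<open>
  The limit is minimal and profinite, so over a PIF group it can only fail to be topologically free
  by failing to be faithful.
\<close>

lemma PIF_kernel_nontrivial:
  assumes "PIF G" "\<not> topologically_free G Y \<tau>"
  shows "\<exists>M. M \<lhd> G \<and> M \<noteq> {\<one>} \<and> (\<forall>K\<in>\<K>. M \<subseteq> K)"
proof -
  interpret \<tau>: group_hom G "BijGroup (topspace Y)" \<tau>
    using group_action_translation by (simp add: group_action_def)
  let ?M = "kernel G (BijGroup (topspace Y)) \<tau>"
  have "\<not> faithful_action G (topspace Y) \<tau>"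
    using PIF_imp_PIF_for[OF assms(1), where ?'x = "'a set \<Rightarrow> 'a set"] assms(2)
      compact_G_space_coset_limit minimal_coset_limit profinite_coset_limit
    unfolding PIF_for_def by blast
  then have "\<not> inj_on \<tau> (carrier G)"
    using group_action_translation by (simp add: faithful_action_def faithful_action_axioms_def)
  then obtain m where "m \<in> ?M" "m \<noteq> \<one>"
    by (auto simp: \<tau>.inj_on_one_iff kernel_def)
  then have "?M \<noteq> {\<one>}" by blast
  then show ?thesis using \<tau>.normal_kernel kernel_coset_limit by blast
qed

end

section \<open>Normal subgroups in the profinite closures of a URS\<close>

context group
begin

lemma set_mult_subset_finite:
  assumes "subgroup H G" "finite_index_normal N G"
  shows "\<exists>F. finite F \<and> F \<subseteq> H \<and> H <#> N \<subseteq> F <#> N"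
proof -
  note N = finite_index_normalD[OF assms(2)]
  interpret N: normal N G by (rule N(1))
  interpret H: subgroup H G by (rule assms(1))
  have fin: "finite ((\<lambda>h. h <# N) ` H)"
  proof (rule finite_subset[OF _ N(3)], rule image_subsetI)
    fix h assume "h \<in> H"
    then have "h \<in> carrier G" by simp
    then show "h <# N \<in> rcosets N" using N.coset_eq by (auto simp: RCOSETS_def)
  qed
  obtain F where F: "F \<subseteq> H" "finite F" "(\<lambda>h. h <# N) ` H = (\<lambda>h. h <# N) ` F"
    using finite_subset_image[OF fin subset_refl] by (elim exE conjE) (rule that)
  have "H <#> N \<subseteq> F <#> N"
  proof
    fix x assume "x \<in> H <#> N"
    then obtain h where h: "h \<in> H" "x \<in> h <# N" by (auto simp: set_mult_def l_coset_def)
    then obtain f where "f \<in> F" "h <# N = f <# N" using F(3) by blast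
    then show "x \<in> F <#> N" using h(2) by (auto simp: set_mult_def l_coset_def)
  qed
  then show ?thesis using F by blast
qed

text \<open>
  \<open>M \<subseteq> HN\<close> is witnessed by finitely many elements of \<open>H\<close>, hence holds for a conjugate of every
  member of the URS; as \<open>M\<close> and \<open>N\<close> are normal, it then holds for the member itself.
\<close>

lemma normal_subset_closure_transfer:
  assumes U: "URS G \<H>" and H: "H \<in> \<H>" "H' \<in> \<H>" and M: "M \<lhd> G"
    and N: "finite_index_normal N G" and sub: "M \<subseteq> H <#> N"
  shows "M \<subseteq> H' <#> N"
proof
  fix m assume m: "m \<in> M"
  note sH = URS_subgroup[OF U H(1)] and sH' = URS_subgroup[OF U H(2)]
  interpret M: normal M G by (rule M)
  interpret N: normal N G by (rule finite_index_normalD(1)[OF N])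
  interpret H': subgroup H' G by (rule sH')
  obtain F where F: "finite F" "F \<subseteq> H" "H <#> N \<subseteq> F <#> N"
    using set_mult_subset_finite[OF sH N] by blast
  obtain g where g: "g \<in> carrier G" "F \<subseteq> conj_action G g H'"
    using URS_conjugate_contains_finite[OF U H F(1,2)] by blast
  have "g \<otimes> m \<otimes> inv g \<in> M" by (rule M.inv_op_closed2[OF g(1) m])
  then obtain f n where f: "f \<in> F" and n: "n \<in> N" and eq: "g \<otimes> m \<otimes> inv g = f \<otimes> n"
    using sub F(3) unfolding set_mult_def by blast
  have fc: "f \<in> carrier G" using f F(2) subgroup.mem_carrier[OF sH] by blast
  have nc: "n \<in> carrier G" and mc: "m \<in> carrier G" using n m by auto
  have "m = inv g \<otimes> (g \<otimes> m \<otimes> inv g) \<otimes> g"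
    using g(1) mc by (simp add: m_assoc[symmetric]) (simp add: m_assoc)
  also have "\<dots> = (inv g \<otimes> f \<otimes> g) \<otimes> (inv g \<otimes> n \<otimes> g)"
    unfolding eq using g(1) fc nc by (simp add: m_assoc mult_inv_cancel_left)
  finally have "m = (inv g \<otimes> f \<otimes> g) \<otimes> (inv g \<otimes> n \<otimes> g)" .
  moreover have "inv g \<otimes> f \<otimes> g \<in> H'" using mem_conj_action_iff[OF sH' g(1) fc] f g(2) by blast
  moreover have "inv g \<otimes> n \<otimes> g \<in> N" by (rule N.inv_op_closed1[OF g(1) n])
  ultimately show "m \<in> H' <#> N" unfolding set_mult_def by blast
qed

lemma profinitely_open_subgroups_containing:
  assumes "subgroup H G"
  shows "profinitely_open_subgroups G ((\<lambda>N. H <#> N) ` {N. finite_index_normal N G})"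
proof (intro profinitely_open_subgroups.intro profinitely_open_subgroups_axioms.intro is_group)
  show "(\<lambda>N. H <#> N) ` {N. finite_index_normal N G} \<noteq> {}" using finite_index_normal_carrier by blast
next
  fix K assume "K \<in> (\<lambda>N. H <#> N) ` {N. finite_index_normal N G}"
  then obtain N where N: "finite_index_normal N G" "K = H <#> N" by blast
  note K = subgroup_mult_normal[OF assms finite_index_normalD(1)[OF N(1)]]
  show "subgroup K G" using K(1) N(2) by simp
  show "\<exists>N. finite_index_normal N G \<and> N \<subseteq> K" using K(3) N by blast
  fix L assume "L \<in> (\<lambda>N. H <#> N) ` {N. finite_index_normal N G}"
  then obtain N' where N': "finite_index_normal N' G" "L = H <#> N'" by blast
  have "H <#> (N \<inter> N') \<subseteq> K" "H <#> (N \<inter> N') \<subseteq> L" using N(2) N'(2) by (auto simp: set_mult_def)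
  then show "\<exists>M\<in>(\<lambda>N. H <#> N) ` {N. finite_index_normal N G}. M \<subseteq> K \<and> M \<subseteq> L"
    using finite_index_normal_Int[OF N(1) N'(1)] by blast
qed

lemma URS_coset_limit_not_topologically_free:
  assumes U: "URS G \<H>" and H: "H \<in> \<H>" "H \<noteq> {\<one>}"
  defines "\<K> \<equiv> (\<lambda>N. H <#> N) ` {N. finite_index_normal N G}"
  shows "\<not> topologically_free G (coset_limit G \<K>) (translation G \<K>)"
proof -
  have sH: "subgroup H G" by (rule URS_subgroup[OF U H(1)])
  interpret profinitely_open_subgroups G \<K>
    unfolding \<K>_def by (rule profinitely_open_subgroups_containing[OF sH])
  obtain h where h: "h \<in> H" "h \<noteq> \<one>" using H(2) subgroup.one_closed[OF sH] by blast
  obtain k t N where k: "k \<in> carrier G" "k \<noteq> \<one>" and t: "t \<in> carrier G"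
    and N: "finite_index_normal N G"
    and conj: "\<And>g M. g \<in> t <# N \<Longrightarrow> finite_index_normal M G \<Longrightarrow> inv g \<otimes> k \<otimes> g \<in> H <#> M"
    using URS_conjugators_have_interior[OF U H(1) h] by blast
  interpret N: normal N G by (rule finite_index_normalD(1)[OF N])
  \<comment> \<open>Since \<open>HN = NH\<close>, a cylinder over \<open>tHN\<close> only sees elements of \<open>tN\<close>, up to right factors in \<open>H\<close>.\<close>
  show ?thesis
  proof (rule not_topologically_free_coset_limit[OF k t, of "H <#> N"])
    show "H <#> N \<in> \<K>" using N by (simp add: \<K>_def)
    fix g K assume g: "g \<in> t <# (H <#> N)" and "K \<in> \<K>"
    then obtain M where M: "finite_index_normal M G" "K = H <#> M" by (auto simp: \<K>_def)
    note K = subgroup_mult_normal[OF sH finite_index_normalD(1)[OF M(1)], folded M(2)]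
    have "g \<in> t <# (N <#> H)" using g commut_normal[OF sH finite_index_normalD(1)[OF N]] by simp
    then obtain n x where nx: "n \<in> N" "x \<in> H" "g = t \<otimes> (n \<otimes> x)"
      by (auto simp: l_coset_def set_mult_def)
    have xc: "x \<in> carrier G" by (rule subgroup.mem_carrier[OF sH nx(2)])
    have tn: "t \<otimes> n \<in> carrier G" "t \<otimes> n \<in> t <# N" using t nx(1) by (auto simp: l_coset_def)
    have eq: "g = t \<otimes> n \<otimes> x" using nx t xc by (simp add: m_assoc)
    have "x \<in> K" using K(2) nx(2) by blast
    moreover have "inv (t \<otimes> n) \<otimes> k \<otimes> (t \<otimes> n) \<in> K" using conj[OF tn(2) M(1)] M(2) by simp
    ultimately show "inv g \<otimes> k \<otimes> g \<in> K"
      using conjugate_mem_right_invariant[OF K(1) k(1) tn(1)] eq by simp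
  qed
qed

end

theorem proposition4p17:
  fixes G :: "('a, 'm) monoid_scheme" and \<H> :: "'a set set"
  assumes "group G" and "PIF G"
    and "URS G \<H>" and "\<H> \<noteq> {{\<one>\<^bsub>G\<^esub>}}"
  shows "\<exists>N. N \<lhd> G \<and> N \<noteq> {\<one>\<^bsub>G\<^esub>} \<and>
           (\<forall>H\<in>\<H>. N \<subseteq> profinite_topology G closure_of H)"
proof -
  interpret group G by (rule assms(1))
  obtain H where H: "H \<in> \<H>" "H \<noteq> {\<one>\<^bsub>G\<^esub>}" using assms(3,4) unfolding URS_def by blast
  let ?\<K> = "(\<lambda>N. H <#>\<^bsub>G\<^esub> N) ` {N. finite_index_normal N G}"
  interpret profinitely_open_subgroups G ?\<K>
    by (rule profinitely_open_subgroups_containing[OF URS_subgroup[OF assms(3) H(1)]])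
  obtain M where M: "M \<lhd> G" "M \<noteq> {\<one>\<^bsub>G\<^esub>}" "\<And>K. K \<in> ?\<K> \<Longrightarrow> M \<subseteq> K"
    using PIF_kernel_nontrivial[OF assms(2) URS_coset_limit_not_topologically_free[OF assms(3) H]] by blast
  have "M \<subseteq> profinite_topology G closure_of H'" if H': "H' \<in> \<H>" for H'
    unfolding profinite_closure_of_subgroup[OF URS_subgroup[OF assms(3) H']]
    using normal_subset_closure_transfer[OF assms(3) H(1) H' M(1)] M(3) by blast
  then show ?thesis using M by blast
qed

end
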